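(* Let $K\subset\mathbb{R}^2$ be a closed (compact), strictly convex domain enclosed by a smooth closed curve $\gamma$ with positive curvature $\kappa>0$. (i) The following inequalities hold: $$\text{(a)}\quad 2L^2+8|\tilde A|+2\int_0^{2\pi}\rho_\beta(\theta)^2\,d\theta+\oint_\gamma\kappa^2\,ds\ \ge\ 20A,$$ $$\text{(b)}\quad 3\int_0^{2\pi}\rho(\theta)^2\,d\theta+(32\pi-38)A+(\pi-1)\int_0^{2\pi}\rho_\beta(\theta)^2\,d\theta\ \ge\ \frac{8\pi-8}{\pi}L^2+(8-2\pi)|\tilde A|,$$ $$\text{(c)}\quad \int_0^{2\pi}\rho(\theta)^2\,d\theta+\Big(\frac{52\pi}{7}-2\Big)A+\frac34\int_0^{2\pi}\rho_\beta(\theta)^2\,d\theta\ \ge\ \frac{13}{7}L^2+\frac{\pi}{7}|\tilde A|,$$ and, for every $\epsilon\in[0,\tfrac12]$, $$\text{(d)}\quad |\tilde A|+\epsilon\int_0^{2\pi}\rho_\beta(\theta)^2\,d\theta+\pi(\rho_M-\rho_m)^2\ \ge\ 2\pi(\rho_e-\rho_i)^2 .$$ (ii) Inequality (a) is strict, i.e. $2L^2+8|\tilde A|+2\int_0^{2\pi}\rho_\beta(\theta)^2\,d\theta+\oint_\gamma\kappa^2\,ds>20A$. (iii) Equality holds in (b) and in (c) if $K$ is a disk. (iv) Equality holds in (d) if and only if $K$ is a disk.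
   Context: Let $\theta$ be the angle between the $x$-axis and the outward normal vector of $\gamma$. The support function of $K$ is $p_K(\theta)=\max_{x\in K}\langle x,(\cos\theta,\sin\theta)\rangle$, which is $2\pi$-periodic and smooth, and $\gamma$ is parametrized by $\gamma(\theta)=(p_K\cos\theta-p_K'\sin\theta,\ p_K\sin\theta+p_K'\cos\theta)$. Notation: - $\kappa=1/(p_K+p_K'')$ is the curvature of $\gamma$, and $\rho(\theta)=1/\kappa(\theta)=p_K(\theta)+p_K''(\theta)$ is its curvature radius; $\rho_M,\rho_m$ are the maximum and minimum of $\rho$ over $[0,2\pi]$. - $L=\int_0^{2\pi}\rho\,d\theta$ is the length of $\gamma$, $A=\frac12\int_0^{2\pi}(p_K^2-p_K'^2)\,d\theta$ is the area of $K$, and $ds=\rho\,d\theta$ is arclength on $\gamma$. - $\beta$ is the locus of curvature centers of $\gamma$: $\beta(\theta)=\gamma(\theta)-\rho(\theta)(\cos\theta,\sin\theta)$. $\tilde A=\frac12\oint_\beta(\beta_1\,d\beta_2-\beta_2\,d\beta_1)=\frac12\int_0^{2\pi}(p_K'^2-p_K''^2)\,d\theta$ is the oriented area enclosed by $\beta$, and $\rho_\beta(\theta)=|p_K'(\theta)+p_K'''(\theta)|$ is the curvature radius of $\beta$. - $\rho_e$ and $\rho_i$ are the circumradius of $\gamma$ (radius of the smallest disk containing $K$) and the inradius (radius of the largest disk contained in $K$). *)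

theory Defs
  imports "HOL-Analysis.Analysis"
begin

definition velocity :: "(real \<Rightarrow> real^2) \<Rightarrow> real \<Rightarrow> real^2" where
  "velocity c t = vector_derivative c (at t)"

text \<open>Infinitely differentiable on the whole real line: \<open>(velocity ^^ n) c\<close> is the
  \<open>n\<close>-th derivative of \<open>c\<close> once all the lower ones are differentiable.\<close>

definition smooth_curve :: "(real \<Rightarrow> real^2) \<Rightarrow> bool" where
  "smooth_curve c \<longleftrightarrow> (\<forall>n t. ((velocity ^^ n) c) differentiable (at t))"

text \<open>A smooth, regular, simple closed curve is given by a parametrization of period 1 on
  all of \<open>\<real>\<close>, so that smoothness holds at the closing point, too. Closedness on \<open>{0..1}\<close>
  follows from periodicity.\<close>

definition smooth_closed_curve :: "(real \<Rightarrow> real^2) \<Rightarrow> bool" where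
  "smooth_closed_curve c \<longleftrightarrow>
     smooth_curve c \<and> (\<forall>t. c (t + 1) = c t) \<and> simple_path c \<and> (\<forall>t. velocity c t \<noteq> 0)"

text \<open>The signed curvature with respect to the left normal. For the boundary of a convex domain
  it is positive everywhere iff the curve runs counterclockwise with nonvanishing curvature.\<close>

definition signed_curvature :: "(real \<Rightarrow> real^2) \<Rightarrow> real \<Rightarrow> real" where
  "signed_curvature c t =
     (velocity c t $ 1 * velocity (velocity c) t $ 2 - velocity c t $ 2 * velocity (velocity c) t $ 1)
       / norm (velocity c t) ^ 3"

definition arc_integral :: "(real \<Rightarrow> real^2) \<Rightarrow> real \<Rightarrow> real \<Rightarrow> (real \<Rightarrow> real) \<Rightarrow> real" where
  "arc_integral c a b f = integral {a..b} (\<lambda>t. f t * norm (velocity c t))"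

definition oriented_area :: "(real \<Rightarrow> real^2) \<Rightarrow> real \<Rightarrow> real \<Rightarrow> real" where
  "oriented_area c a b =
     1/2 * integral {a..b} (\<lambda>t. c t $ 1 * velocity c t $ 2 - c t $ 2 * velocity c t $ 1)"

definition strictly_convex :: "(real^2) set \<Rightarrow> bool" where
  "strictly_convex K \<longleftrightarrow>
     (\<forall>x\<in>K. \<forall>y\<in>K. x \<noteq> y \<longrightarrow> open_segment x y \<subseteq> interior K)"

definition strictly_convex_domain_enclosed_by :: "(real^2) set \<Rightarrow> (real \<Rightarrow> real^2) \<Rightarrow> bool" where
  "strictly_convex_domain_enclosed_by K c \<longleftrightarrow>
     compact K \<and> interior K \<noteq> {} \<and> strictly_convex K \<and>
     smooth_closed_curve c \<and> path_image c = frontier K \<and> (\<forall>t. signed_curvature c t > 0)"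

definition is_disk :: "(real^2) set \<Rightarrow> bool" where
  "is_disk K \<longleftrightarrow> (\<exists>x r. r > 0 \<and> K = cball x r)"

definition circumradius :: "(real^2) set \<Rightarrow> real" where
  "circumradius K = Inf {r. 0 \<le> r \<and> (\<exists>x. K \<subseteq> cball x r)}"

definition inradius :: "(real^2) set \<Rightarrow> real" where
  "inradius K = Sup {r. 0 \<le> r \<and> (\<exists>x. cball x r \<subseteq> K)}"

definition unit_vec :: "real \<Rightarrow> real^2" where
  "unit_vec \<theta> = vector [cos \<theta>, sin \<theta>]"

text \<open>Below, \<open>\<theta>\<close> is the angle between the \<open>x\<close>-axis and the outer normal of the boundary.
  The supremum is a maximum for compact nonempty \<open>K\<close>.\<close>

definition support_fun :: "(real^2) set \<Rightarrow> real \<Rightarrow> real" where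
  "support_fun K \<theta> = (SUP x\<in>K. x \<bullet> unit_vec \<theta>)"

definition boundary_curve :: "(real^2) set \<Rightarrow> real \<Rightarrow> real^2" where
  "boundary_curve K \<theta> = (let p = support_fun K in
     vector [p \<theta> * cos \<theta> - deriv p \<theta> * sin \<theta>, p \<theta> * sin \<theta> + deriv p \<theta> * cos \<theta>])"

text \<open>For a smooth support function \<open>p\<close> with \<open>p + p'' > 0\<close>, the velocity of \<open>boundary_curve\<close> at \<open>\<theta>\<close>
  is \<open>(p + p'') (- sin \<theta>, cos \<theta>)\<close>, so \<open>p + p''\<close> is the radius of curvature and
  \<open>ds = (p + p'') d\<theta>\<close>.\<close>

definition curv_radius :: "(real^2) set \<Rightarrow> real \<Rightarrow> real" where
  "curv_radius K \<theta> = support_fun K \<theta> + (deriv ^^ 2) (support_fun K) \<theta>"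

definition curv :: "(real^2) set \<Rightarrow> real \<Rightarrow> real" where
  "curv K \<theta> = 1 / curv_radius K \<theta>"

definition max_curv_radius :: "(real^2) set \<Rightarrow> real" where
  "max_curv_radius K = (SUP \<theta>\<in>{0..2*pi}. curv_radius K \<theta>)"

definition min_curv_radius :: "(real^2) set \<Rightarrow> real" where
  "min_curv_radius K = (INF \<theta>\<in>{0..2*pi}. curv_radius K \<theta>)"

definition area :: "(real^2) set \<Rightarrow> real" where
  "area K = measure lebesgue K"

definition boundary_length :: "(real^2) set \<Rightarrow> real" where
  "boundary_length K = arc_integral (boundary_curve K) 0 (2*pi) (\<lambda>\<theta>. 1)"

definition evolute :: "(real^2) set \<Rightarrow> real \<Rightarrow> real^2" where
  "evolute K \<theta> = boundary_curve K \<theta> - curv_radius K \<theta> *\<^sub>R unit_vec \<theta>"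

definition evolute_area :: "(real^2) set \<Rightarrow> real" where
  "evolute_area K = oriented_area (evolute K) 0 (2*pi)"

definition evolute_curv_radius :: "(real^2) set \<Rightarrow> real \<Rightarrow> real" where
  "evolute_curv_radius K \<theta> = \<bar>deriv (support_fun K) \<theta> + (deriv ^^ 3) (support_fun K) \<theta>\<bar>"

end

theory Submission
  imports Defs
begin

text \<open>
  Write \<open>p\<close> for the support function of \<open>K\<close> as a function of the normal angle, and
  \<open>E n = (\<integral>p cos n\<theta>)\<^sup>2 + (\<integral>p sin n\<theta>)\<^sup>2\<close>. The curvature radius is \<open>\<rho> = p + p''\<close>, and the
  quantities in the inequalities are

    \<open>L = \<integral>p\<close>, \<open>2A = \<integral>p\<^sup>2 - \<integral>p'\<^sup>2\<close>, \<open>2\<bar>A'\<bar> = \<integral>p''\<^sup>2 - \<integral>p'\<^sup>2\<close>,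
    \<open>\<integral>\<rho>\<^sup>2 = \<integral>p\<^sup>2 - 2\<integral>p'\<^sup>2 + \<integral>p''\<^sup>2\<close>, \<open>\<integral>(p' + p''')\<^sup>2 = \<integral>p'\<^sup>2 - 2\<integral>p''\<^sup>2 + \<integral>p'''\<^sup>2\<close>.

  By Parseval they are all diagonal in the frequency \<open>n\<close>: each is a multiple of \<open>L\<^sup>2\<close> plus a sum over
  \<open>n \<ge> 1\<close> of \<open>E n\<close> times a polynomial in \<open>m = n\<^sup>2\<close>. In (b) and (c) the coefficients are such that
  \<open>L\<^sup>2\<close> cancels (whence equality for disks). For (b) the polynomial is
  \<open>(\<pi> - 1) (m - 1) (m - 4) (m + 4)\<close>; for (c) it is a combination of \<open>m (m - 1) (m - 4)\<close>,
  \<open>(m - 1) (m - 4)\<close> and \<open>m\<^sup>2 - 1\<close> with nonnegative coefficients. All of these are nonnegative at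
  squares, because no square lies strictly between \<open>1\<close> and \<open>4\<close>. The resulting integral inequalities
  are \<open>wirtinger\<close> and \<open>second_order_wirtinger\<close>. Inequality (a) is strict since already
  \<open>2 L\<^sup>2 \<ge> 8 \<pi> A > 20 A\<close>, by the isoperimetric inequality.

  Inequality (d) follows from \<open>2 \<pi> (\<rho>e - \<rho>i)\<^sup>2 \<le> 8/9 \<pi> (\<rho>M - \<rho>m)\<^sup>2\<close>, and since \<open>8/9 < 1\<close>, equality
  in (d) forces \<open>\<rho>M = \<rho>m\<close>. To see this, note that the \<open>n\<close>-th mode of \<open>p\<close> is that of \<open>\<rho>\<close>
  divided by \<open>1 - n\<^sup>2\<close>. The modes of frequency 1 are removed by a translation of \<open>K\<close>, and after it the
  Cauchy--Schwarz inequality gives \<open>\<bar>p - L/2\<pi>\<bar> \<le> (\<rho>M - \<rho>m)/3\<close> (\<open>support_near_constant\<close>). So \<open>K\<close> lies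
  between two concentric disks whose radii differ by \<open>2/3 (\<rho>M - \<rho>m)\<close> (\<open>nearly_round\<close>).

  Completeness of the trigonometric system is obtained from the Basel sum. A periodic function is, up
  to its mean, the convolution of its derivative with a sawtooth, and \<open>\<Sum>1/n\<^sup>2 = \<pi>\<^sup>2/6\<close> says exactly that
  the Fourier sums of this one function converge in the quadratic mean; this carries over to all
  periodic \<open>C\<^sup>1\<close> functions.

  On the geometric side, positive curvature makes the tangent angle a strictly increasing function of
  the parameter of \<open>\<gamma>\<close>, so \<open>\<gamma>\<close> can be parametrized by its normal angle. The point with a given normal
  angle is the support point of \<open>K\<close> in that direction; hence \<open>p\<close> is three times continuously
  differentiable and \<open>\<rho>\<close> is positive. The area formula follows by sweeping \<open>K\<close> with segments from an
  interior point to the boundary.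
\<close>

section \<open>Fourier series of periodic functions\<close>

definition cos_coeff :: "(real \<Rightarrow> real) \<Rightarrow> nat \<Rightarrow> real" where
  "cos_coeff f n = integral {0..2*pi} (\<lambda>x. f x * cos (real n * x))"

definition sin_coeff :: "(real \<Rightarrow> real) \<Rightarrow> nat \<Rightarrow> real" where
  "sin_coeff f n = integral {0..2*pi} (\<lambda>x. f x * sin (real n * x))"

text \<open>Squared modulus of the unnormalized \<open>n\<close>-th Fourier coefficient. This is the form in which the
  coefficients enter quadratic integrals.\<close>

definition energy :: "(real \<Rightarrow> real) \<Rightarrow> nat \<Rightarrow> real" where
  "energy f n = (cos_coeff f n)\<^sup>2 + (sin_coeff f n)\<^sup>2"

definition fourier_sum :: "(real \<Rightarrow> real) \<Rightarrow> nat \<Rightarrow> real \<Rightarrow> real" where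
  "fourier_sum f N x = integral {0..2*pi} f / (2*pi) +
     (\<Sum>n=1..N. cos_coeff f n * cos (real n * x) + sin_coeff f n * sin (real n * x)) / pi"

lemma continuous_fourier_sum [continuous_intros]: "continuous_on S (fourier_sum f N)"
  unfolding fourier_sum_def by (intro continuous_intros) auto

lemma has_integral_cos_int:
  "((\<lambda>x. cos (of_int k * x)) has_integral (if k = 0 then 2*pi else 0)) {0..2*pi}"
proof (cases "k = 0")
  case True
  then show ?thesis using has_integral_const_real[of "1::real" 0 "2*pi"] by simp
next
  case False
  have "((\<lambda>x. cos (of_int k * x)) has_integral
      (sin (of_int k * (2*pi)) / of_int k - sin (of_int k * 0) / of_int k)) {0..2*pi}"
    using False by (intro fundamental_theorem_of_calculus)
      (auto intro!: derivative_eq_intros simp: has_real_derivative_iff_has_vector_derivative[symmetric])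
  moreover have "sin (of_int k * (2*pi)) = 0"
    using sin_int_2pin[of k] by (simp add: mult_ac)
  ultimately show ?thesis using False by simp
qed

lemma has_integral_sin_int:
  "((\<lambda>x. sin (of_int k * x)) has_integral 0) {0..2*pi}"
proof (cases "k = 0")
  case True
  then show ?thesis by simp
next
  case False
  have "((\<lambda>x. sin (of_int k * x)) has_integral
      (- cos (of_int k * (2*pi)) / of_int k - - cos (of_int k * 0) / of_int k)) {0..2*pi}"
    using False by (intro fundamental_theorem_of_calculus)
      (auto intro!: derivative_eq_intros simp: has_real_derivative_iff_has_vector_derivative[symmetric])
  moreover have "cos (of_int k * (2*pi)) = 1"
    using cos_int_2pin[of k] by (simp add: mult_ac)
  ultimately show ?thesis using False by simp
qed

lemma trig_orthogonal:
  fixes n m :: nat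
  assumes "m \<ge> 1"
  shows "((\<lambda>x. cos (real n * x) * cos (real m * x)) has_integral (if n = m then pi else 0)) {0..2*pi}"
    and "((\<lambda>x. sin (real n * x) * sin (real m * x)) has_integral (if n = m then pi else 0)) {0..2*pi}"
    and "((\<lambda>x. sin (real n * x) * cos (real m * x)) has_integral 0) {0..2*pi}"
    and "((\<lambda>x. cos (real n * x) * sin (real m * x)) has_integral 0) {0..2*pi}"
proof -
  let ?d = "int n - int m" and ?s = "int n + int m"
  have s: "?s \<noteq> 0" using assms by simp
  note i = has_integral_cos_int[of ?d] has_integral_cos_int[of ?s]
           has_integral_sin_int[of ?d] has_integral_sin_int[of ?s]
  note e = left_diff_distrib distrib_right of_int_diff of_int_add of_int_of_nat_eq
  show "((\<lambda>x. cos (real n * x) * cos (real m * x)) has_integral (if n = m then pi else 0)) {0..2*pi}"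
    by (rule has_integral_eq_rhs)
      (use has_integral_divide[OF has_integral_add[OF i(1,2)], of 2] in
        \<open>simp only: cos_times_cos e\<close>, use s in auto)
  show "((\<lambda>x. sin (real n * x) * sin (real m * x)) has_integral (if n = m then pi else 0)) {0..2*pi}"
    by (rule has_integral_eq_rhs)
      (use has_integral_divide[OF has_integral_diff[OF i(1,2)], of 2] in
        \<open>simp only: sin_times_sin e\<close>, use s in auto)
  show "((\<lambda>x. sin (real n * x) * cos (real m * x)) has_integral 0) {0..2*pi}"
    using has_integral_divide[OF has_integral_add[OF i(4,3)], of 2]
    by (simp add: sin_times_cos e)
  show "((\<lambda>x. cos (real n * x) * sin (real m * x)) has_integral 0) {0..2*pi}"
    using has_integral_divide[OF has_integral_diff[OF i(4,3)], of 2]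
    by (simp add: cos_times_sin e)
qed

lemma fourier_sum_orthogonal:
  assumes "m > N"
  shows "((\<lambda>x. fourier_sum f N x * cos (real m * x)) has_integral 0) {0..2*pi}"
    and "((\<lambda>x. fourier_sum f N x * sin (real m * x)) has_integral 0) {0..2*pi}"
proof -
  have m: "m \<ge> 1" using assms by simp
  let ?I = "integral {0..2*pi} f"
  have c0: "((\<lambda>x. cos (real m * x)) has_integral 0) {0..2*pi}"
    using has_integral_cos_int[of "int m"] m by simp
  have s0: "((\<lambda>x. sin (real m * x)) has_integral 0) {0..2*pi}"
    using has_integral_sin_int[of "int m"] by simp
  have "((\<lambda>x. ?I / (2*pi) * cos (real m * x) +
     (\<Sum>n=1..N. cos_coeff f n * (cos (real n * x) * cos (real m * x)) +
        sin_coeff f n * (sin (real n * x) * cos (real m * x))) / pi) has_integral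
     (?I / (2*pi) * 0 + (\<Sum>n=1..N. cos_coeff f n * (if n = m then pi else 0) + sin_coeff f n * 0) / pi)) {0..2*pi}"
    by (intro has_integral_add has_integral_mult_right has_integral_divide has_integral_sum c0
        trig_orthogonal m) auto
  also have "(?I / (2*pi) * 0 + (\<Sum>n=1..N. cos_coeff f n * (if n = m then pi else 0) + sin_coeff f n * 0) / pi) = 0"
    using assms by auto
  finally show "((\<lambda>x. fourier_sum f N x * cos (real m * x)) has_integral 0) {0..2*pi}"
    by (simp add: fourier_sum_def algebra_simps sum_distrib_left add_divide_distrib)
  have "((\<lambda>x. ?I / (2*pi) * sin (real m * x) +
     (\<Sum>n=1..N. cos_coeff f n * (cos (real n * x) * sin (real m * x)) +
        sin_coeff f n * (sin (real n * x) * sin (real m * x))) / pi) has_integral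
     (?I / (2*pi) * 0 + (\<Sum>n=1..N. cos_coeff f n * 0 + sin_coeff f n * (if n = m then pi else 0)) / pi)) {0..2*pi}"
    by (intro has_integral_add has_integral_mult_right has_integral_divide has_integral_sum s0
        trig_orthogonal m) auto
  also have "(?I / (2*pi) * 0 + (\<Sum>n=1..N. cos_coeff f n * 0 + sin_coeff f n * (if n = m then pi else 0)) / pi) = 0"
    using assms by auto
  finally show "((\<lambda>x. fourier_sum f N x * sin (real m * x)) has_integral 0) {0..2*pi}"
    by (simp add: fourier_sum_def algebra_simps sum_distrib_left add_divide_distrib)
qed

text \<open>Pythagoras, one frequency at a time: the remainder after \<open>N\<close> modes still has the \<open>(N+1)\<close>-st Fourier
  coefficients of \<open>f\<close>, since the Fourier sum is orthogonal to the next mode.\<close>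

lemma bessel_identity:
  assumes f: "continuous_on {0..2*pi} f"
  shows "((\<lambda>x. (f x - fourier_sum f N x)\<^sup>2) has_integral
    integral {0..2*pi} (\<lambda>x. (f x)\<^sup>2) - (integral {0..2*pi} f)\<^sup>2 / (2*pi) - (\<Sum>n=1..N. energy f n) / pi)
    {0..2*pi}"
proof (induction N)
  case 0
  let ?I = "integral {0..2*pi} f"
  have f2: "((\<lambda>x. (f x)\<^sup>2) has_integral integral {0..2*pi} (\<lambda>x. (f x)\<^sup>2)) {0..2*pi}"
    by (intro integrable_integral integrable_continuous_real continuous_intros f)
  have f1: "(f has_integral ?I) {0..2*pi}"
    by (intro integrable_integral integrable_continuous_real f)
  have "((\<lambda>x. (f x)\<^sup>2 - ?I/pi * f x + (?I/(2*pi))\<^sup>2) has_integral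
      (integral {0..2*pi} (\<lambda>x. (f x)\<^sup>2) - ?I/pi * ?I + (2*pi - 0) *\<^sub>R (?I/(2*pi))\<^sup>2)) {0..2*pi}"
    by (intro has_integral_add has_integral_diff has_integral_mult_right f1 f2 has_integral_const_real[THEN has_integral_eq_rhs]) auto
  also have "(\<lambda>x. (f x)\<^sup>2 - ?I/pi * f x + (?I/(2*pi))\<^sup>2) = (\<lambda>x. (f x - fourier_sum f 0 x)\<^sup>2)"
    by (auto simp: fourier_sum_def fun_eq_iff field_simps power2_eq_square)
  also have "(integral {0..2*pi} (\<lambda>x. (f x)\<^sup>2) - ?I/pi * ?I + (2*pi - 0) *\<^sub>R (?I/(2*pi))\<^sup>2)
    = integral {0..2*pi} (\<lambda>x. (f x)\<^sup>2) - ?I\<^sup>2 / (2*pi) - (\<Sum>n=1..0. energy f n) / pi"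
    by (simp add: field_simps power2_eq_square)
  finally show ?case .
next
  case (Suc N)
  let ?m = "Suc N"
  let ?a = "cos_coeff f ?m" and ?b = "sin_coeff f ?m"
  let ?r = "\<lambda>x. f x - fourier_sum f N x"
  let ?c = "\<lambda>x. cos (real ?m * x)" and ?s = "\<lambda>x. sin (real ?m * x)"
  have "((\<lambda>x. f x * ?c x) has_integral ?a) {0..2*pi}" "((\<lambda>x. f x * ?s x) has_integral ?b) {0..2*pi}"
    unfolding cos_coeff_def sin_coeff_def
    by (intro integrable_integral integrable_continuous_real continuous_intros f)+
  then have rc: "((\<lambda>x. ?r x * ?c x) has_integral ?a) {0..2*pi}"
    and rs: "((\<lambda>x. ?r x * ?s x) has_integral ?b) {0..2*pi}"
    using fourier_sum_orthogonal[of N ?m f, THEN has_integral_diff[rotated]]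
    by (fastforce simp: algebra_simps)+
  note o = trig_orthogonal[of ?m ?m]
  have "((\<lambda>x. (?r x)\<^sup>2 - (2/pi) * (?a * (?r x * ?c x) + ?b * (?r x * ?s x))
      + (?a\<^sup>2 * (?c x * ?c x) + ?b\<^sup>2 * (?s x * ?s x) + 2 * ?a * ?b * (?s x * ?c x)) / pi\<^sup>2) has_integral
     ((integral {0..2*pi} (\<lambda>x. (f x)\<^sup>2) - (integral {0..2*pi} f)\<^sup>2 / (2*pi) - (\<Sum>n=1..N. energy f n) / pi)
       - (2/pi) * (?a * ?a + ?b * ?b) + (?a\<^sup>2 * pi + ?b\<^sup>2 * pi + 2 * ?a * ?b * 0) / pi\<^sup>2)) {0..2*pi}"
    using o by (intro has_integral_add has_integral_diff has_integral_mult_right has_integral_divide Suc.IH rc rs)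
      auto
  also have "(\<lambda>x. (?r x)\<^sup>2 - (2/pi) * (?a * (?r x * ?c x) + ?b * (?r x * ?s x))
      + (?a\<^sup>2 * (?c x * ?c x) + ?b\<^sup>2 * (?s x * ?s x) + 2 * ?a * ?b * (?s x * ?c x)) / pi\<^sup>2)
     = (\<lambda>x. (f x - fourier_sum f ?m x)\<^sup>2)"
  proof
    fix x
    have "f x - fourier_sum f ?m x = ?r x - (?a * ?c x + ?b * ?s x) / pi"
      by (simp add: fourier_sum_def add_divide_distrib)
    then show "(?r x)\<^sup>2 - (2/pi) * (?a * (?r x * ?c x) + ?b * (?r x * ?s x))
      + (?a\<^sup>2 * (?c x * ?c x) + ?b\<^sup>2 * (?s x * ?s x) + 2 * ?a * ?b * (?s x * ?c x)) / pi\<^sup>2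
      = (f x - fourier_sum f ?m x)\<^sup>2"
      by (simp only: power2_diff power_divide) (simp add: field_simps power2_eq_square)
  qed
  finally show ?case
    by (rule has_integral_eq_rhs) (simp add: energy_def field_simps power2_eq_square)
qed

lemma bessel_inequality:
  assumes "continuous_on {0..2*pi} f"
  shows "(\<Sum>n=1..N. energy f n) \<le> pi * integral {0..2*pi} (\<lambda>x. (f x)\<^sup>2) - (integral {0..2*pi} f)\<^sup>2 / 2"
proof -
  have "0 \<le> integral {0..2*pi} (\<lambda>x. (f x)\<^sup>2) - (integral {0..2*pi} f)\<^sup>2 / (2*pi) - (\<Sum>n=1..N. energy f n) / pi"
    by (rule has_integral_nonneg[OF bessel_identity[OF assms]]) simp
  then have "(\<Sum>n=1..N. energy f n) / pi \<le> integral {0..2*pi} (\<lambda>x. (f x)\<^sup>2) - (integral {0..2*pi} f)\<^sup>2 / (2*pi)" by simp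
  then have "(\<Sum>n=1..N. energy f n) \<le> (integral {0..2*pi} (\<lambda>x. (f x)\<^sup>2) - (integral {0..2*pi} f)\<^sup>2 / (2*pi)) * pi"
    by (simp add: pos_divide_le_eq)
  then show ?thesis by (simp add: algebra_simps)
qed

lemma has_integral_derivative:
  fixes F f :: "real \<Rightarrow> real"
  assumes "\<And>x. (F has_real_derivative f x) (at x)" "a \<le> b"
  shows "(f has_integral (F b - F a)) {a..b}"
  using assms by (intro fundamental_theorem_of_calculus)
    (auto simp: has_real_derivative_iff_has_vector_derivative[symmetric] intro: has_field_derivative_at_within)

text \<open>The quadratic polynomial \<open>t \<mapsto> \<integral>(t a + b)\<^sup>2\<close> is nonnegative. Its leading coefficient may be zero, and
  then the linear one must vanish as well.\<close>

lemma integral_Cauchy_Schwarz: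
  fixes a b :: "real \<Rightarrow> real"
  assumes a: "continuous_on {c..d} a" and b: "continuous_on {c..d} b"
  shows "(integral {c..d} (\<lambda>x. a x * b x))\<^sup>2 \<le>
     integral {c..d} (\<lambda>x. (a x)\<^sup>2) * integral {c..d} (\<lambda>x. (b x)\<^sup>2)"
proof -
  let ?A = "integral {c..d} (\<lambda>x. (a x)\<^sup>2)" and ?B = "integral {c..d} (\<lambda>x. (b x)\<^sup>2)"
    and ?C = "integral {c..d} (\<lambda>x. a x * b x)"
  have quad: "0 \<le> t\<^sup>2 * ?A + 2 * t * ?C + ?B" for t
  proof -
    have "((\<lambda>x. t\<^sup>2 * (a x)\<^sup>2 + 2 * t * (a x * b x) + (b x)\<^sup>2) has_integral
        t\<^sup>2 * ?A + 2 * t * ?C + ?B) {c..d}"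
      by (intro has_integral_add has_integral_mult_right integrable_integral integrable_continuous_real
          continuous_intros a b)
    then show ?thesis
    proof (rule has_integral_nonneg)
      fix x
      have "t\<^sup>2 * (a x)\<^sup>2 + 2 * t * (a x * b x) + (b x)\<^sup>2 = (t * a x + b x)\<^sup>2"
        by (simp add: power2_eq_square algebra_simps)
      then show "0 \<le> t\<^sup>2 * (a x)\<^sup>2 + 2 * t * (a x * b x) + (b x)\<^sup>2" by simp
    qed
  qed
  show ?thesis
  proof (cases "?A = 0")
    case True
    have "?C = 0"
    proof (rule ccontr)
      assume "?C \<noteq> 0"
      with quad[of "- (?B + 1) / (2 * ?C)"] True show False by (simp add: field_simps)
    qed
    then show ?thesis using True by simp
  next
    case False
    moreover have "?A \<ge> 0"
      by (intro integral_nonneg integrable_continuous_real continuous_intros a) auto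
    ultimately have "?A > 0" by simp
    with quad[of "- ?C / ?A"] show ?thesis by (simp add: field_simps power2_eq_square)
  qed
qed

lemma integral_periodic_shift:
  fixes f :: "real \<Rightarrow> real"
  assumes f: "continuous_on UNIV f" and per: "\<And>x. f (x + 2*pi) = f x" and x: "0 \<le> x" "x \<le> 2*pi"
  shows "integral {0..2*pi} (\<lambda>t. f (x + t)) = integral {0..2*pi} f"
proof -
  have int: "f integrable_on {a..b}" for a b
    by (intro integrable_continuous_real continuous_on_subset[OF f]) auto
  have "integral {0..2*pi} (\<lambda>t. f (x + t)) = integral {x..x + 2*pi} f"
    using integral_shift_Icc_real[of 0 "2*pi" f x] by (simp add: o_def algebra_simps)
  also have "\<dots> = integral {x..2*pi} f + integral {2*pi..x+2*pi} f"
    using x by (intro Henstock_Kurzweil_Integration.integral_combine[symmetric] int) auto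
  also have "integral {2*pi..x+2*pi} f = integral {0..x} f"
    using integral_shift_Icc_real[of 0 x f "2*pi"] per by (simp add: o_def add.commute)
  also have "integral {x..2*pi} f + integral {0..x} f = integral {0..2*pi} f"
    using x Henstock_Kurzweil_Integration.integral_combine[of 0 x "2*pi" f] int by simp
  finally show ?thesis .
qed

text \<open>On one period this is the kernel \<open>s\<close> with \<open>f x = mean f + \<integral>s t * f' (x + t)\<close> for all periodic
  \<open>C\<^sup>1\<close> functions \<open>f\<close>: it has slope \<open>1/2\<pi>\<close> and jumps by \<open>-1\<close> at the multiples of \<open>2\<pi>\<close>.\<close>

definition sawtooth :: "real \<Rightarrow> real" where
  "sawtooth t = (t - pi) / (2*pi)"

lemma trig_2pi_nat [simp]: "cos (real n * (2*pi)) = 1" "sin (real n * (2*pi)) = 0"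
  using cos_int_2pin[of "int n"] sin_int_2pin[of "int n"] by (simp_all add: mult_ac)

lemma sawtooth_coeffs:
  shows "integral {0..2*pi} sawtooth = 0"
    and "integral {0..2*pi} (\<lambda>t. (sawtooth t)\<^sup>2) = pi / 6"
    and "n \<ge> 1 \<Longrightarrow> cos_coeff sawtooth n = 0"
    and "n \<ge> 1 \<Longrightarrow> sin_coeff sawtooth n = - 1 / real n"
proof -
  have "(sawtooth has_integral ((2*pi - pi)\<^sup>2 / (4*pi) - (0 - pi)\<^sup>2 / (4*pi))) {0..2*pi}"
    unfolding sawtooth_def by (rule has_integral_derivative) (auto intro!: derivative_eq_intros simp: field_simps)
  then show "integral {0..2*pi} sawtooth = 0" by (simp add: integral_unique)
  have "((\<lambda>t. (sawtooth t)\<^sup>2) has_integral ((2*pi - pi)^3 / (12*pi\<^sup>2) - (0 - pi)^3 / (12*pi\<^sup>2))) {0..2*pi}"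
    unfolding sawtooth_def
    by (rule has_integral_derivative) (auto intro!: derivative_eq_intros simp: field_simps power2_eq_square)
  then show "integral {0..2*pi} (\<lambda>t. (sawtooth t)\<^sup>2) = pi / 6"
    by (simp add: integral_unique field_simps power2_eq_square power3_eq_cube)
  assume n: "n \<ge> 1"
  let ?F = "\<lambda>t. ((t - pi) * sin (real n * t) / real n + cos (real n * t) / (real n)\<^sup>2) / (2*pi)"
  have "((\<lambda>t. sawtooth t * cos (real n * t)) has_integral (?F (2*pi) - ?F 0)) {0..2*pi}"
    unfolding sawtooth_def using n
    by (intro has_integral_derivative) (auto intro!: derivative_eq_intros simp: field_simps power2_eq_square)
  then show "cos_coeff sawtooth n = 0" by (simp add: cos_coeff_def integral_unique)
  let ?G = "\<lambda>t. (- (t - pi) * cos (real n * t) / real n + sin (real n * t) / (real n)\<^sup>2) / (2*pi)"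
  have "((\<lambda>t. sawtooth t * sin (real n * t)) has_integral (?G (2*pi) - ?G 0)) {0..2*pi}"
    unfolding sawtooth_def using n
    by (intro has_integral_derivative) (auto intro!: derivative_eq_intros simp: field_simps power2_eq_square)
  then show "sin_coeff sawtooth n = - 1 / real n"
    using n by (simp only: sin_coeff_def integral_unique trig_2pi_nat) (simp add: field_simps)
qed

text \<open>The quadratic error of the Fourier sums is \<open>\<pi>/6 - (\<Sum>n\<le>N. 1/n\<^sup>2)/\<pi>\<close> by Bessel's identity, and it tends
  to zero because \<open>\<Sum>1/n\<^sup>2 = \<pi>\<^sup>2/6\<close>.\<close>

lemma sawtooth_tail:
  "(\<lambda>N. integral {0..2*pi} (\<lambda>t. (sawtooth t - fourier_sum sawtooth N t)\<^sup>2)) \<longlonglongrightarrow> 0"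
proof -
  have cont: "continuous_on {0..2*pi} sawtooth"
    unfolding sawtooth_def by (intro continuous_intros) auto
  have "(\<lambda>N. \<Sum>n<N. 1 / (real n + 1)\<^sup>2) \<longlonglongrightarrow> pi\<^sup>2 / 6"
    using inverse_squares_sums by (simp add: sums_def add.commute)
  moreover have "(\<Sum>n<N. 1 / (real n + 1)\<^sup>2) = (\<Sum>n=1..N. energy sawtooth n)" for N
    unfolding One_nat_def sum.atLeast1_atMost_eq
    by (intro sum.cong) (auto simp: energy_def sawtooth_coeffs power_divide add_ac)
  ultimately have "(\<lambda>N. pi / 6 - (\<Sum>n=1..N. energy sawtooth n) / pi) \<longlonglongrightarrow> pi / 6 - (pi\<^sup>2 / 6) / pi"
    by (intro tendsto_intros) auto
  moreover have "integral {0..2*pi} (\<lambda>t. (sawtooth t - fourier_sum sawtooth N t)\<^sup>2)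
      = pi / 6 - (\<Sum>n=1..N. energy sawtooth n) / pi" for N
    by (simp add: integral_unique[OF bessel_identity[OF cont]] sawtooth_coeffs)
  moreover have "pi / 6 - (pi\<^sup>2 / 6) / pi = 0" by (simp add: power2_eq_square)
  ultimately show ?thesis by (simp only: )
qed

locale periodic_C1 =
  fixes f f' :: "real \<Rightarrow> real"
  assumes deriv: "\<And>x. (f has_real_derivative f' x) (at x)"
    and cont': "continuous_on UNIV f'"
    and periodic: "\<And>x. f (x + 2*pi) = f x"
begin

lemma cont: "continuous_on S f"
  using deriv by (intro DERIV_continuous_on) (auto intro: has_field_derivative_at_within)

lemma deriv_comp [derivative_intros]:
  "(g has_real_derivative g') (at x within S) \<Longrightarrow>
   ((\<lambda>x. f (g x)) has_real_derivative f' (g x) * g') (at x within S)"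
  by (rule DERIV_chain2[OF deriv])

lemma deriv_coeffs:
  "cos_coeff f' n = real n * sin_coeff f n" "sin_coeff f' n = - real n * cos_coeff f n"
proof -
  have f2pi: "f (2*pi) = f 0" using periodic[of 0] by simp
  have c: "((\<lambda>x. f x * cos (real n * x)) has_integral cos_coeff f n) {0..2*pi}"
    and s: "((\<lambda>x. f x * sin (real n * x)) has_integral sin_coeff f n) {0..2*pi}"
    unfolding cos_coeff_def sin_coeff_def
    by (intro integrable_integral integrable_continuous_real continuous_intros cont)+
  have "((\<lambda>x. f' x * cos (real n * x) - real n * (f x * sin (real n * x))) has_integral
     (f (2*pi) * cos (real n * (2*pi)) - f 0 * cos (real n * 0))) {0..2*pi}"
    by (rule has_integral_derivative) (auto intro!: derivative_eq_intros simp: algebra_simps)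
  from has_integral_add[OF this has_integral_mult_right[OF s, of "real n"]]
  show "cos_coeff f' n = real n * sin_coeff f n"
    by (simp add: cos_coeff_def integral_unique f2pi)
  have "((\<lambda>x. f' x * sin (real n * x) + real n * (f x * cos (real n * x))) has_integral
     (f (2*pi) * sin (real n * (2*pi)) - f 0 * sin (real n * 0))) {0..2*pi}"
    by (rule has_integral_derivative) (auto intro!: derivative_eq_intros simp: algebra_simps)
  from has_integral_diff[OF this has_integral_mult_right[OF c, of "real n"]]
  show "sin_coeff f' n = - real n * cos_coeff f n"
    by (simp add: sin_coeff_def integral_unique f2pi)
qed

lemma deriv_mean: "integral {0..2*pi} f' = 0"
proof -
  have "(f' has_integral (f (2*pi) - f 0)) {0..2*pi}"
    by (rule fundamental_theorem_of_calculus)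
      (auto simp: has_real_derivative_iff_has_vector_derivative[symmetric]
        intro: has_field_derivative_at_within deriv)
  then show ?thesis using periodic[of 0] by (simp add: integral_unique)
qed

lemma energy_deriv: "energy f' n = (real n)\<^sup>2 * energy f n"
  by (simp add: energy_def deriv_coeffs power_mult_distrib algebra_simps)

text \<open>Forming the Fourier sum commutes with convolution. Thus the remainder of \<open>f\<close> is the remainder of the
  sawtooth convolved with \<open>f'\<close>, and it is small as soon as that of the sawtooth is.\<close>

lemma fourier_remainder:
  assumes x: "0 \<le> x" "x \<le> 2*pi"
  shows "f x - fourier_sum f N x =
     integral {0..2*pi} (\<lambda>t. (sawtooth t - fourier_sum sawtooth N t) * f' (x + t))"
proof -
  have shift: "f (2*pi + x) = f x" using periodic[of x] by (simp add: add.commute)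
  have i1: "((\<lambda>t. f (x + t)) has_integral integral {0..2*pi} f) {0..2*pi}"
    unfolding integral_periodic_shift[where f = f, OF cont periodic x, symmetric]
    by (intro integrable_integral integrable_continuous_real continuous_on_compose2[OF cont] continuous_intros) auto
  have "((\<lambda>t. f (x + t) / (2*pi) + sawtooth t * f' (x + t)) has_integral
     (sawtooth (2*pi) * f (x + 2*pi) - sawtooth 0 * f (x + 0))) {0..2*pi}"
    unfolding sawtooth_def by (rule has_integral_derivative) (auto intro!: derivative_eq_intros simp: field_simps)
  from has_integral_diff[OF this has_integral_divide[OF i1, of "2*pi"]]
  moreover have "sawtooth (2*pi) = 1/2" "sawtooth 0 = - 1/2" by (simp_all add: sawtooth_def)
  ultimately have saw: "((\<lambda>t. sawtooth t * f' (x + t)) has_integral f x - integral {0..2*pi} f / (2*pi)) {0..2*pi}"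
    by (simp add: shift add.commute[of x])
  \<comment> \<open>Integration by parts without boundary terms turns \<open>f'\<close> into \<open>f\<close>, and
    the shift of a periodic integral turns the phase into an addition formula.\<close>
  have mode: "((\<lambda>t. sin (real n * t) * f' (x + t)) has_integral
      - real n * (cos_coeff f n * cos (real n * x) + sin_coeff f n * sin (real n * x))) {0..2*pi}" for n
  proof -
    let ?g = "\<lambda>y. f y * cos (real n * (y - x))"
    have per: "?g (y + 2*pi) = ?g y" for y
    proof -
      have "cos (real n * (y + 2*pi - x)) = cos (real n * (y - x) + real n * (2*pi))"
        by (simp add: algebra_simps)
      then show ?thesis by (simp only: cos_add trig_2pi_nat periodic) simp
    qed
    have g_expand: "?g = (\<lambda>y. f y * cos (real n * y) * cos (real n * x) + f y * sin (real n * y) * sin (real n * x))"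
      by (rule ext) (simp only: right_diff_distrib cos_diff, simp add: distrib_left)
    have "((\<lambda>y. f y * cos (real n * y) * cos (real n * x) + f y * sin (real n * y) * sin (real n * x))
       has_integral cos_coeff f n * cos (real n * x) + sin_coeff f n * sin (real n * x)) {0..2*pi}"
      unfolding cos_coeff_def sin_coeff_def
      by (intro has_integral_add has_integral_mult_left integrable_integral integrable_continuous_real
          continuous_intros cont)
    then have "integral {0..2*pi} ?g = cos_coeff f n * cos (real n * x) + sin_coeff f n * sin (real n * x)"
      by (intro integral_unique) (simp only: g_expand)
    moreover have "integral {0..2*pi} (\<lambda>t. ?g (x + t)) = integral {0..2*pi} ?g"
      by (rule integral_periodic_shift[where f = ?g, OF _ per x]) (intro continuous_intros cont)
    moreover have "(\<lambda>t. ?g (x + t)) integrable_on {0..2*pi}"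
      by (intro integrable_continuous_real continuous_intros continuous_on_compose2[OF cont]) auto
    ultimately have g: "((\<lambda>t. f (x + t) * cos (real n * t)) has_integral
       cos_coeff f n * cos (real n * x) + sin_coeff f n * sin (real n * x)) {0..2*pi}"
      unfolding has_integral_iff by (simp only: add_diff_cancel_left' simp_thms)
    have "((\<lambda>t. real n * (f (x + t) * cos (real n * t)) + sin (real n * t) * f' (x + t)) has_integral
       (sin (real n * (2*pi)) * f (x + 2*pi) - sin (real n * 0) * f (x + 0))) {0..2*pi}"
      by (rule has_integral_derivative) (auto intro!: derivative_eq_intros simp: field_simps)
    from has_integral_diff[OF this has_integral_mult_right[OF g, of "real n"]]
    show ?thesis by simp
  qed
  have "((\<lambda>t. sawtooth t * f' (x + t) - (\<Sum>n=1..N. (-1/real n) * (sin (real n * t) * f' (x + t))) / pi)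
     has_integral (f x - integral {0..2*pi} f / (2*pi)) -
      (\<Sum>n=1..N. (-1/real n) * (- real n * (cos_coeff f n * cos (real n * x) + sin_coeff f n * sin (real n * x)))) / pi) {0..2*pi}"
    by (intro has_integral_diff has_integral_divide has_integral_sum has_integral_mult_right saw mode) auto
  also have "(\<lambda>t. sawtooth t * f' (x + t) - (\<Sum>n=1..N. (-1/real n) * (sin (real n * t) * f' (x + t))) / pi)
    = (\<lambda>t. (sawtooth t - fourier_sum sawtooth N t) * f' (x + t))"
  proof
    fix t
    have "fourier_sum sawtooth N t = (\<Sum>n=1..N. (-1/real n) * sin (real n * t)) / pi"
      unfolding fourier_sum_def sawtooth_coeffs
      by (simp add: sawtooth_coeffs)
    then show "sawtooth t * f' (x + t) - (\<Sum>n=1..N. (-1/real n) * (sin (real n * t) * f' (x + t))) / pi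
      = (sawtooth t - fourier_sum sawtooth N t) * f' (x + t)"
      by (simp add: left_diff_distrib sum_distrib_right mult.assoc)
  qed
  also have "(f x - integral {0..2*pi} f / (2*pi)) -
      (\<Sum>n=1..N. (-1/real n) * (- real n * (cos_coeff f n * cos (real n * x) + sin_coeff f n * sin (real n * x)))) / pi
     = f x - fourier_sum f N x"
    by (simp add: fourier_sum_def add.commute)
  finally show ?thesis by (simp add: integral_unique)
qed

lemma periodic_deriv: "f' (x + 2*pi) = f' x"
proof -
  have "((\<lambda>x. f (x + 2*pi)) has_real_derivative f' (x + 2*pi)) (at x)"
    by (auto intro!: derivative_eq_intros)
  then show ?thesis using DERIV_unique deriv periodic by (simp add: fun_eq_iff) blast
qed

lemma fourier_remainder_bound:
  assumes x: "0 \<le> x" "x \<le> 2*pi"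
  shows "(f x - fourier_sum f N x)\<^sup>2 \<le>
     integral {0..2*pi} (\<lambda>t. (sawtooth t - fourier_sum sawtooth N t)\<^sup>2) * integral {0..2*pi} (\<lambda>t. (f' t)\<^sup>2)"
proof -
  have "continuous_on {0..2*pi} (\<lambda>t. sawtooth t - fourier_sum sawtooth N t)"
    unfolding sawtooth_def by (intro continuous_intros) auto
  moreover have "continuous_on {0..2*pi} (\<lambda>t. f' (x + t))"
    by (intro continuous_on_compose2[OF cont'] continuous_intros) auto
  moreover have "integral {0..2*pi} (\<lambda>t. (f' (x + t))\<^sup>2) = integral {0..2*pi} (\<lambda>t. (f' t)\<^sup>2)"
    by (rule integral_periodic_shift[where f = "\<lambda>t. (f' t)\<^sup>2", OF _ _ x])
      (auto simp: periodic_deriv intro!: continuous_intros cont')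
  ultimately show ?thesis
    unfolding fourier_remainder[OF x]
    using integral_Cauchy_Schwarz[of 0 "2*pi" "\<lambda>t. sawtooth t - fourier_sum sawtooth N t" "\<lambda>t. f' (x + t)"]
    by simp
qed

lemma fourier_pointwise:
  assumes x: "0 \<le> x" "x \<le> 2*pi"
  shows "(\<lambda>N. fourier_sum f N x) \<longlonglongrightarrow> f x"
proof -
  have "(\<lambda>N. integral {0..2*pi} (\<lambda>t. (sawtooth t - fourier_sum sawtooth N t)\<^sup>2) *
      integral {0..2*pi} (\<lambda>t. (f' t)\<^sup>2)) \<longlonglongrightarrow> 0"
    using tendsto_mult_left_zero[OF sawtooth_tail] by simp
  then have "(\<lambda>N. (f x - fourier_sum f N x)\<^sup>2) \<longlonglongrightarrow> 0"
    by (rule tendsto_sandwich[OF _ _ tendsto_const, rotated 2])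
      (auto intro!: always_eventually fourier_remainder_bound x)
  then have "(\<lambda>N. f x - fourier_sum f N x) \<longlonglongrightarrow> 0"
    by (simp add: tendsto_null_power)
  from tendsto_diff[OF tendsto_const[of "f x"] this] show ?thesis by simp
qed

text \<open>By \<open>fourier_remainder_bound\<close> the remainder is small uniformly on the period, so the remainder in
  Bessel's identity tends to zero.\<close>

theorem parseval:
  "(\<lambda>n. energy f (Suc n)) sums (pi * integral {0..2*pi} (\<lambda>x. (f x)\<^sup>2) - (integral {0..2*pi} f)\<^sup>2 / 2)"
proof -
  let ?c = "integral {0..2*pi} (\<lambda>x. (f x)\<^sup>2) - (integral {0..2*pi} f)\<^sup>2 / (2*pi)"
  let ?e = "\<lambda>N. integral {0..2*pi} (\<lambda>t. (sawtooth t - fourier_sum sawtooth N t)\<^sup>2) * integral {0..2*pi} (\<lambda>t. (f' t)\<^sup>2)"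
  note b = bessel_identity[OF cont[of "{0..2*pi}"]]
  have upper: "?c - (\<Sum>n=1..N. energy f n) / pi \<le> 2*pi * ?e N" for N
  proof (rule has_integral_le[OF b])
    show "((\<lambda>x. ?e N) has_integral 2*pi * ?e N) {0..2*pi}"
      using has_integral_const_real[of "?e N" 0 "2*pi"] by simp
  qed (simp add: fourier_remainder_bound)
  have lower: "0 \<le> ?c - (\<Sum>n=1..N. energy f n) / pi" for N
    by (rule has_integral_nonneg[OF b]) simp
  have "(\<lambda>N. 2*pi * ?e N) \<longlonglongrightarrow> 0"
    by (rule tendsto_mult_right_zero[OF tendsto_mult_left_zero[OF sawtooth_tail]])
  then have "(\<lambda>N. ?c - (\<Sum>n=1..N. energy f n) / pi) \<longlonglongrightarrow> 0"
    by (rule tendsto_sandwich[OF always_eventually always_eventually tendsto_const, rotated 2])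
      (use lower upper in auto)
  from tendsto_mult_left[OF tendsto_diff[OF tendsto_const[of ?c] this], of pi]
  have "(\<lambda>N. \<Sum>n=1..N. energy f n) \<longlonglongrightarrow> pi * ?c" by simp
  moreover have "(\<Sum>n=1..N. energy f n) = (\<Sum>n<N. energy f (Suc n))" for N
    unfolding One_nat_def sum.atLeast1_atMost_eq ..
  moreover have "pi * ?c = pi * integral {0..2*pi} (\<lambda>x. (f x)\<^sup>2) - (integral {0..2*pi} f)\<^sup>2 / 2"
    by (simp add: right_diff_distrib)
  ultimately show ?thesis by (simp add: sums_def)
qed

end

section \<open>Quadratic integrals of a periodic support function\<close>

text \<open>For \<open>n \<ge> 3\<close> the factor \<open>n\<^sup>2 - 1\<close> is at least \<open>8\<close>, so the terms are at most \<open>1 / (8 (n\<^sup>2 - 1))\<close>, which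
  telescopes. Telescoping with the factor \<open>3\<close> from \<open>n = 2\<close> on would only give \<open>1/4\<close>, a bound too weak to
  decide the case of equality in (d).\<close>

lemma sum_inverse_gap_squares_le:
  "(\<Sum>n=2..N. 1 / ((real n)\<^sup>2 - 1)\<^sup>2) \<le> 1/6"
proof -
  have "(\<Sum>n=2..N. 1 / ((real n)\<^sup>2 - 1)\<^sup>2) \<le> 1/6 - (1 / real N + 1 / (real N + 1)) / 16" if "N \<ge> 2"
    using that
  proof (induction N rule: nat_induct_at_least)
    case base
    then show ?case by (simp add: power2_eq_square)
  next
    case (Suc n)
    let ?x = "real n"
    have x: "?x \<ge> 2" using Suc by simp
    have pos: "(1 + ?x)\<^sup>2 - 1 = ?x * (?x + 2)" by (simp add: power2_eq_square algebra_simps)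
    have "?x * (?x + 2) \<ge> 8" using mult_mono[of 2 ?x 4 "?x + 2"] x by simp
    moreover have "?x * (?x + 2) > 0" using x by simp
    ultimately have "1 / (?x * (?x + 2))\<^sup>2 \<le> 1 / (8 * (?x * (?x + 2)))"
      unfolding power2_eq_square by (intro divide_left_mono mult_right_mono) auto
    also have "\<dots> = (1 / ?x + 1 / (?x + 1)) / 16 - (1 / (?x + 1) + 1 / (?x + 2)) / 16"
    proof -
      have "?x > 0" using x by simp
      then have "1 / (8 * (?x * (?x + 2))) = (1 / ?x - 1 / (?x + 2)) / 16" by (simp add: divide_simps)
      then show ?thesis by (simp only: diff_divide_distrib add_divide_distrib)
    qed
    finally show ?case using Suc by (simp add: pos add_ac)
  qed
  moreover have "(\<Sum>n=2..N. 1 / ((real n)\<^sup>2 - 1)\<^sup>2) = 0" if "N < 2" using that by simp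
  moreover have "(1 / real N + 1 / (real N + 1)) / 16 \<ge> 0" by simp
  ultimately show ?thesis
  proof (cases "N \<ge> 2")
    case True
    then show ?thesis using \<open>(1 / real N + 1 / (real N + 1)) / 16 \<ge> 0\<close>
      \<open>N \<ge> 2 \<Longrightarrow> (\<Sum>n=2..N. 1 / ((real n)\<^sup>2 - 1)\<^sup>2) \<le> 1/6 - (1 / real N + 1 / (real N + 1)) / 16\<close>
      by linarith
  qed simp
qed

text \<open>The third derivative is only continuous, so Parseval is available for \<open>p\<close>, \<open>p1\<close>, \<open>p2\<close> but only Bessel's
  inequality for \<open>p3\<close>. That suffices, because \<open>\<integral>p3\<^sup>2\<close> occurs on the larger side of each inequality.\<close>

locale periodic_C3 =
  fixes p p1 p2 p3 :: "real \<Rightarrow> real"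
  assumes d0: "\<And>x. (p has_real_derivative p1 x) (at x)"
    and d1: "\<And>x. (p1 has_real_derivative p2 x) (at x)"
    and d2: "\<And>x. (p2 has_real_derivative p3 x) (at x)"
    and c3: "continuous_on UNIV p3"
    and per: "\<And>x. p (x + 2*pi) = p x"
begin

lemma cont_on: "continuous_on S p" "continuous_on S p1" "continuous_on S p2" "continuous_on S p3"
  using DERIV_continuous_on[OF has_field_derivative_at_within[OF d0]]
    DERIV_continuous_on[OF has_field_derivative_at_within[OF d1]]
    DERIV_continuous_on[OF has_field_derivative_at_within[OF d2]] continuous_on_subset[OF c3]
  by auto

sublocale P0: periodic_C1 p p1
  by unfold_locales (simp_all add: d0 per cont_on)

sublocale P1: periodic_C1 p1 p2
  by unfold_locales (simp_all add: d1 P0.periodic_deriv cont_on)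

sublocale P2: periodic_C1 p2 p3
  by unfold_locales (simp_all add: d2 P1.periodic_deriv cont_on)

definition "L = integral {0..2*pi} p"
definition "J0 = integral {0..2*pi} (\<lambda>x. (p x)\<^sup>2)"
definition "J1 = integral {0..2*pi} (\<lambda>x. (p1 x)\<^sup>2)"
definition "J2 = integral {0..2*pi} (\<lambda>x. (p2 x)\<^sup>2)"
definition "J3 = integral {0..2*pi} (\<lambda>x. (p3 x)\<^sup>2)"

lemmas J_defs = J0_def J1_def J2_def J3_def

lemma periodic_2pi: "p (2*pi) = p 0" "p1 (2*pi) = p1 0" "p2 (2*pi) = p2 0"
  using P0.periodic[of 0] P1.periodic[of 0] P2.periodic[of 0] by simp_all

lemma J_has_integral:
  "((\<lambda>x. (p x)\<^sup>2) has_integral J0) {0..2*pi}" "((\<lambda>x. (p1 x)\<^sup>2) has_integral J1) {0..2*pi}"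
  "((\<lambda>x. (p2 x)\<^sup>2) has_integral J2) {0..2*pi}" "((\<lambda>x. (p3 x)\<^sup>2) has_integral J3) {0..2*pi}"
  unfolding J_defs
  by (intro integrable_integral integrable_continuous_real continuous_intros cont_on)+

lemma L_has_integral: "(p has_integral L) {0..2*pi}"
  unfolding L_def by (intro integrable_integral integrable_continuous_real cont_on)

lemma p2_has_integral: "(p2 has_integral 0) {0..2*pi}"
  using P1.deriv_mean by (metis integrable_integral integrable_continuous_real cont_on(3))

lemma integrals_by_parts:
  "((\<lambda>x. p x * p2 x) has_integral - J1) {0..2*pi}"
  "((\<lambda>x. p1 x * p3 x) has_integral - J2) {0..2*pi}"
proof -
  have "((\<lambda>x. p x * p2 x + (p1 x)\<^sup>2) has_integral (p (2*pi) * p1 (2*pi) - p 0 * p1 0)) {0..2*pi}"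
    by (rule has_integral_derivative) (auto intro!: derivative_eq_intros simp: power2_eq_square)
  from has_integral_diff[OF this J_has_integral(2)]
  show "((\<lambda>x. p x * p2 x) has_integral - J1) {0..2*pi}" by (simp add: periodic_2pi)
  have "((\<lambda>x. p1 x * p3 x + (p2 x)\<^sup>2) has_integral (p1 (2*pi) * p2 (2*pi) - p1 0 * p2 0)) {0..2*pi}"
    by (rule has_integral_derivative) (auto intro!: derivative_eq_intros simp: power2_eq_square)
  from has_integral_diff[OF this J_has_integral(3)]
  show "((\<lambda>x. p1 x * p3 x) has_integral - J2) {0..2*pi}" by (simp add: periodic_2pi)
qed

text \<open>The curvature radius if \<open>p\<close> is the support function of a convex curve.\<close>

definition rho :: "real \<Rightarrow> real" where "rho x = p x + p2 x"

lemma cont_rho: "continuous_on S rho"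
  unfolding rho_def by (intro continuous_intros cont_on)

lemma rho_integrals:
  "(rho has_integral L) {0..2*pi}"
  "((\<lambda>x. (rho x)\<^sup>2) has_integral J0 - 2 * J1 + J2) {0..2*pi}"
  "((\<lambda>x. (p1 x + p3 x)\<^sup>2) has_integral J1 - 2 * J2 + J3) {0..2*pi}"
  "((\<lambda>x. p x * rho x) has_integral J0 - J1) {0..2*pi}"
proof -
  show "(rho has_integral L) {0..2*pi}"
    unfolding rho_def using has_integral_add[OF L_has_integral p2_has_integral] by simp
  show "((\<lambda>x. (rho x)\<^sup>2) has_integral J0 - 2 * J1 + J2) {0..2*pi}"
    using has_integral_add[OF has_integral_add[OF J_has_integral(1) has_integral_mult_right[OF integrals_by_parts(1), of 2]] J_has_integral(3)]
    by (simp add: rho_def power2_sum algebra_simps)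
  show "((\<lambda>x. (p1 x + p3 x)\<^sup>2) has_integral J1 - 2 * J2 + J3) {0..2*pi}"
    using has_integral_add[OF has_integral_add[OF J_has_integral(2) has_integral_mult_right[OF integrals_by_parts(2), of 2]] J_has_integral(4)]
    by (simp add: power2_sum algebra_simps)
  show "((\<lambda>x. p x * rho x) has_integral J0 - J1) {0..2*pi}"
    using has_integral_add[OF J_has_integral(1) integrals_by_parts(1)]
    by (simp add: rho_def power2_eq_square algebra_simps)
qed

lemma energy_rho: "energy rho n = ((real n)\<^sup>2 - 1)\<^sup>2 * energy p n"
proof -
  have "cos_coeff rho n = cos_coeff p n + cos_coeff p2 n"
    unfolding cos_coeff_def rho_def distrib_right
    by (intro Henstock_Kurzweil_Integration.integral_add integrable_continuous_real continuous_intros cont_on)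
  moreover have "sin_coeff rho n = sin_coeff p n + sin_coeff p2 n"
    unfolding sin_coeff_def rho_def distrib_right
    by (intro Henstock_Kurzweil_Integration.integral_add integrable_continuous_real continuous_intros cont_on)
  ultimately have "cos_coeff rho n = - ((real n)\<^sup>2 - 1) * cos_coeff p n"
    "sin_coeff rho n = - ((real n)\<^sup>2 - 1) * sin_coeff p n"
    by (simp_all add: P0.deriv_coeffs P1.deriv_coeffs power2_eq_square algebra_simps)
  then show ?thesis unfolding energy_def by (simp only: power_mult_distrib power2_minus distrib_left)
qed

text \<open>The square integral of \<open>p\<close> minus its mean.\<close>

definition J0_centred :: real where "J0_centred = J0 - L\<^sup>2 / (2*pi)"

lemma energy_sums:
  "(\<lambda>n. energy p (Suc n)) sums (pi * J0_centred)"
  "(\<lambda>n. (real (Suc n))^2 * energy p (Suc n)) sums (pi * J1)"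
  "(\<lambda>n. (real (Suc n))^4 * energy p (Suc n)) sums (pi * J2)"
  "(\<Sum>n<N. (real (Suc n))^6 * energy p (Suc n)) \<le> pi * J3"
proof -
  show "(\<lambda>n. energy p (Suc n)) sums (pi * J0_centred)"
    using P0.parseval by (simp add: J0_def[symmetric] L_def[symmetric] J0_centred_def right_diff_distrib)
  show "(\<lambda>n. (real (Suc n))^2 * energy p (Suc n)) sums (pi * J1)"
    using P1.parseval by (simp add: J1_def[symmetric] P0.deriv_mean P0.energy_deriv)
  have 4: "energy p2 n = (real n)^4 * energy p n" for n
    by (simp add: P0.energy_deriv P1.energy_deriv flip: mult.assoc power_add)
  show "(\<lambda>n. (real (Suc n))^4 * energy p (Suc n)) sums (pi * J2)"
    using P2.parseval by (simp add: J2_def[symmetric] P1.deriv_mean 4)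
  have 6: "energy p3 n = (real n)^6 * energy p n" for n
    by (simp add: P2.energy_deriv 4 flip: mult.assoc power_add)
  show "(\<Sum>n<N. (real (Suc n))^6 * energy p (Suc n)) \<le> pi * J3"
    using bessel_inequality[of p3 N] cont_on(4)
    by (simp add: J3_def[symmetric] P2.deriv_mean 6 sum.atLeast1_atMost_eq)
qed

lemma energy_nonneg: "energy f n \<ge> 0"
  by (simp add: energy_def)

text \<open>Wirtinger's inequality \<open>1 \<le> n\<^sup>2\<close> for \<open>p\<close> and for its derivative. The first one is the
  isoperimetric inequality in terms of the support function.\<close>

lemma wirtinger: "J0_centred \<le> J1" "J1 \<le> J2"
proof -
  have 1: "(real (Suc n))^2 \<ge> 1" for n by (rule one_le_power) simp
  have "pi * J0_centred \<le> pi * J1"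
    by (rule sums_le[OF _ energy_sums(1,2)]) (use mult_right_mono[OF 1 energy_nonneg] in simp)
  then show "J0_centred \<le> J1" by simp
  have "(real (Suc n))^2 \<le> (real (Suc n))^4" for n by (rule power_increasing) auto
  then have "pi * J1 \<le> pi * J2"
    by (intro sums_le[OF _ energy_sums(2,3)] mult_right_mono energy_nonneg)
  then show "J1 \<le> J2" by simp
qed

lemma frequency_gap_nonneg: "((real n)^2 - 1) * ((real n)^2 - 4) \<ge> 0"
proof (cases "n \<ge> 2")
  case True
  then have "(real n)^2 \<ge> 2^2" by (intro power_mono) auto
  then show ?thesis by simp
next
  case False
  then have "n = 0 \<or> n = 1" by auto
  then show ?thesis by auto
qed

text \<open>The reason is that \<open>(n\<^sup>2 - 1) (n\<^sup>2 - 4) \<ge> 0\<close> for all \<open>n\<close>: the right-hand sides are, up to the factor \<open>\<pi>\<close>,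
  equal to \<open>\<Sum>(n\<^sup>2 - 1) (n\<^sup>2 - 4) E n\<close> and at least \<open>\<Sum>n\<^sup>2 (n\<^sup>2 - 1) (n\<^sup>2 - 4) E n\<close>.\<close>

lemma second_order_wirtinger:
  "0 \<le> J2 - 5 * J1 + 4 * J0_centred" "0 \<le> J3 - 5 * J2 + 4 * J1"
proof -
  have eq: "(real m)^4 * e - 5 * ((real m)^2 * e) + 4 * e = ((real m)^2 - 1) * ((real m)^2 - 4) * e" for m e
    by (simp add: algebra_simps flip: power_add)
  have "0 \<le> pi * J2 - 5 * (pi * J1) + 4 * (pi * J0_centred)"
  proof (rule sums_le)
    show "(\<lambda>n. (real (Suc n))^4 * energy p (Suc n) - 5 * ((real (Suc n))^2 * energy p (Suc n)) + 4 * energy p (Suc n))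
       sums (pi * J2 - 5 * (pi * J1) + 4 * (pi * J0_centred))"
      by (intro sums_add sums_diff sums_mult energy_sums)
    show "(\<lambda>_. 0) sums (0::real)" by (rule sums_zero)
  qed (simp only: eq mult_nonneg_nonneg[OF frequency_gap_nonneg energy_nonneg])
  then have "0 \<le> pi * (J2 - 5 * J1 + 4 * J0_centred)" by (simp add: algebra_simps)
  then show "0 \<le> J2 - 5 * J1 + 4 * J0_centred" by (simp add: zero_le_mult_iff) (use pi_gt_zero in linarith)
  let ?S = "\<lambda>k N. \<Sum>n<N. (real (Suc n))^k * energy p (Suc n)"
  have bound: "0 \<le> pi * J3 - 5 * ?S 4 N + 4 * ?S 2 N" for N
  proof -
    have eq6: "(real m)^6 * e - 5 * ((real m)^4 * e) + 4 * ((real m)^2 * e)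
        = ((real m)^2 - 1) * ((real m)^2 - 4) * ((real m)^2 * e)" for m e
      by (simp add: algebra_simps flip: power_add)
    have "?S 6 N - 5 * ?S 4 N + 4 * ?S 2 N =
      (\<Sum>n<N. ((real (Suc n))^2 - 1) * ((real (Suc n))^2 - 4) * ((real (Suc n))^2 * energy p (Suc n)))"
      by (simp only: sum_distrib_left sum_subtractf[symmetric] sum.distrib[symmetric] eq6)
    also have "\<dots> \<ge> 0"
      by (intro sum_nonneg mult_nonneg_nonneg[OF frequency_gap_nonneg] mult_nonneg_nonneg energy_nonneg) simp
    finally show ?thesis using energy_sums(4)[of N] by simp
  qed
  have "(\<lambda>N. pi * J3 - 5 * ?S 4 N + 4 * ?S 2 N) \<longlonglongrightarrow> pi * J3 - 5 * (pi * J2) + 4 * (pi * J1)"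
    using energy_sums(2,3) unfolding sums_def by (intro tendsto_intros)
  then have "0 \<le> pi * J3 - 5 * (pi * J2) + 4 * (pi * J1)"
    by (rule LIMSEQ_le_const) (use bound in blast)
  then have "0 \<le> pi * (J3 - 5 * J2 + 4 * J1)" by (simp add: algebra_simps)
  then show "0 \<le> J3 - 5 * J2 + 4 * J1" by (simp add: zero_le_mult_iff) (use pi_gt_zero in linarith)
qed

text \<open>The mode \<open>n\<close> of \<open>p\<close> is that of \<open>rho\<close> divided by \<open>1 - n\<^sup>2\<close>. By the Cauchy--Schwarz inequality the sum of
  the modes \<open>n \<ge> 2\<close> is controlled by the variance of \<open>rho\<close> and by \<open>\<Sum>1/(n\<^sup>2 - 1)\<^sup>2 \<le> 1/6\<close>, and the variance
  by the oscillation of \<open>rho\<close>. The mode \<open>n = 1\<close> is the trigonometric term on the left.\<close>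

lemma support_near_constant:
  assumes bounds: "\<And>x. x \<in> {0..2*pi} \<Longrightarrow> m \<le> rho x \<and> rho x \<le> M"
  obtains a b where "\<And>x. x \<in> {0..2*pi} \<Longrightarrow> \<bar>p x - (a * cos x + b * sin x) - L / (2*pi)\<bar> \<le> (M - m) / 3"
proof -
  let ?V = "J0 - 2 * J1 + J2 - L\<^sup>2 / (2*pi)"
  \<comment> \<open>The variance bound \<open>(M - m)\<^sup>2 / 4\<close> for a function with values in \<open>[m, M]\<close> comes from
    \<open>(M - rho) (rho - m) \<ge> 0\<close>.\<close>
  have "0 \<le> (M + m) * L - (J0 - 2 * J1 + J2) - 2*pi * (M * m)"
  proof (rule has_integral_nonneg)
    show "((\<lambda>x. (M + m) * rho x - (rho x)\<^sup>2 - M * m) has_integral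
        (M + m) * L - (J0 - 2 * J1 + J2) - 2*pi * (M * m)) {0..2*pi}"
      by (intro has_integral_diff has_integral_mult_right rho_integrals
          has_integral_const_real[THEN has_integral_eq_rhs]) simp
    fix x assume "x \<in> {0..2*pi}"
    then have "0 \<le> (M - rho x) * (rho x - m)" using bounds by simp
    then show "0 \<le> (M + m) * rho x - (rho x)\<^sup>2 - M * m" by (simp add: power2_eq_square algebra_simps)
  qed
  moreover have "(M + m) * L - 2*pi * (M * m) - L\<^sup>2 / (2*pi)
      = pi / 2 * (M - m)\<^sup>2 - (L - pi * (M + m))\<^sup>2 / (2*pi)"
    by (simp add: field_simps power2_eq_square)
  moreover have "(L - pi * (M + m))\<^sup>2 / (2*pi) \<ge> 0" by simp
  ultimately have V: "?V \<le> pi / 2 * (M - m)\<^sup>2" by linarith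
  have "m \<le> M" using bounds[of 0] by simp
  let ?a = "cos_coeff p 1 / pi" and ?b = "sin_coeff p 1 / pi"
  have "\<bar>p x - (?a * cos x + ?b * sin x) - L / (2*pi)\<bar> \<le> (M - m) / 3" if x: "x \<in> {0..2*pi}" for x
  proof -
    let ?e = "\<lambda>n. cos_coeff p n * cos (real n * x) + sin_coeff p n * sin (real n * x)"
    have e2: "(?e n)\<^sup>2 \<le> energy p n" for n
    proof -
      let ?c = "cos (real n * x)" and ?s = "sin (real n * x)"
      have "(?e n)\<^sup>2 + (cos_coeff p n * ?s - sin_coeff p n * ?c)\<^sup>2 = energy p n * (?s\<^sup>2 + ?c\<^sup>2)"
        unfolding energy_def by algebra
      moreover have "?s\<^sup>2 + ?c\<^sup>2 = 1" by simp
      moreover have "(cos_coeff p n * ?s - sin_coeff p n * ?c)\<^sup>2 \<ge> 0" by simp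
      ultimately show ?thesis by (simp only: mult_1_right)
    qed
    have tail: "(\<Sum>n=2..N. ?e n)\<^sup>2 \<le> pi\<^sup>2 / 12 * (M - m)\<^sup>2" for N
    proof -
      have ne: "(real n)\<^sup>2 - 1 \<noteq> 0" if "n \<in> {2..N}" for n
      proof -
        have "(2::real)\<^sup>2 \<le> (real n)\<^sup>2" using that by (intro power_mono) auto
        then show ?thesis by simp
      qed
      have "(\<Sum>n=2..N. ?e n) = (\<Sum>n=2..N. (((real n)\<^sup>2 - 1) * ?e n) * (1 / ((real n)\<^sup>2 - 1)))"
        by (intro sum.cong refl) (use ne in simp)
      then have "(\<Sum>n=2..N. ?e n)\<^sup>2 \<le> (\<Sum>n=2..N. (((real n)\<^sup>2 - 1) * ?e n)\<^sup>2) * (\<Sum>n=2..N. (1 / ((real n)\<^sup>2 - 1))\<^sup>2)"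
        using Cauchy_Schwarz_ineq_sum[of "\<lambda>n. ((real n)\<^sup>2 - 1) * ?e n" "\<lambda>n. 1 / ((real n)\<^sup>2 - 1)" "{2..N}"]
        by (simp only:)
      also have "\<dots> \<le> (pi * ?V) * (1/6)"
      proof (rule mult_mono)
        have "(\<Sum>n=2..N. (((real n)\<^sup>2 - 1) * ?e n)\<^sup>2) \<le> (\<Sum>n=2..N. energy rho n)"
          unfolding energy_rho power_mult_distrib by (intro sum_mono mult_left_mono e2) simp
        also have "\<dots> \<le> (\<Sum>n=1..N. energy rho n)"
          by (intro sum_mono2) (auto intro: energy_nonneg)
        also have "\<dots> \<le> pi * (J0 - 2 * J1 + J2) - L\<^sup>2 / 2"
          using bessel_inequality[OF cont_rho, of N] rho_integrals(1,2) by (simp add: integral_unique)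
        also have "\<dots> = pi * ?V" by (simp add: right_diff_distrib)
        finally show "(\<Sum>n=2..N. (((real n)\<^sup>2 - 1) * ?e n)\<^sup>2) \<le> pi * ?V" .
        then show "0 \<le> pi * ?V" by (rule order_trans[rotated]) (simp add: sum_nonneg)
      qed (use sum_inverse_gap_squares_le in \<open>simp_all add: power_divide sum_nonneg\<close>)
      also have "\<dots> \<le> pi * (pi / 2 * (M - m)\<^sup>2) * (1/6)"
        using V by (intro mult_right_mono mult_left_mono) auto
      finally show ?thesis by (simp add: power2_eq_square)
    qed
    have "\<bar>fourier_sum p N x - (?a * cos x + ?b * sin x) - L / (2*pi)\<bar> \<le> (M - m) / 3" if "N \<ge> 1" for N
    proof -
      have "fourier_sum p N x - (?a * cos x + ?b * sin x) - L / (2*pi) = (\<Sum>n=2..N. ?e n) / pi"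
        using that by (simp add: fourier_sum_def L_def sum.atLeast_Suc_atMost add_divide_distrib numeral_2_eq_2)
      moreover have "((\<Sum>n=2..N. ?e n) / pi)\<^sup>2 \<le> ((M - m) / 3)\<^sup>2"
      proof -
        have "((\<Sum>n=2..N. ?e n) / pi)\<^sup>2 \<le> (pi\<^sup>2 / 12 * (M - m)\<^sup>2) / pi\<^sup>2"
          unfolding power_divide by (intro divide_right_mono tail) simp
        also have "\<dots> = (M - m)\<^sup>2 / 12" by simp
        also have "\<dots> \<le> (M - m)\<^sup>2 / 9" by (intro divide_left_mono) auto
        finally show ?thesis by (simp add: power_divide)
      qed
      ultimately have "\<bar>fourier_sum p N x - (?a * cos x + ?b * sin x) - L / (2*pi)\<bar> \<le> \<bar>(M - m) / 3\<bar>"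
        by (simp only: abs_le_square_iff)
      then show ?thesis using \<open>m \<le> M\<close> by simp
    qed
    moreover have "(\<lambda>N. \<bar>fourier_sum p N x - (?a * cos x + ?b * sin x) - L / (2*pi)\<bar>)
        \<longlonglongrightarrow> \<bar>p x - (?a * cos x + ?b * sin x) - L / (2*pi)\<bar>"
      using x by (intro tendsto_intros P0.fourier_pointwise) auto
    ultimately show ?thesis by (intro LIMSEQ_le_const2) blast+
  qed
  then show thesis by (rule that)
qed

text \<open>The curve is a circle here, but its centre is arbitrary, so \<open>p\<close> itself need not be constant.\<close>

lemma integrals_of_constant_rho:
  assumes "\<And>x. rho x = r"
  shows "L = 2*pi*r" "J0 - 2*J1 + J2 = 2*pi*r\<^sup>2" "J1 - 2*J2 + J3 = 0" "J0 - J1 = 2*pi*r\<^sup>2" "J2 - J1 = 0"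
proof -
  have L: "L = 2*pi*r"
    using has_integral_unique[OF rho_integrals(1)] has_integral_const_real[of r 0 "2*pi"]
    by (simp add: assms cong: has_integral_cong)
  have R: "J0 - 2*J1 + J2 = 2*pi*r\<^sup>2"
    using has_integral_unique[OF rho_integrals(2)] has_integral_const_real[of "r\<^sup>2" 0 "2*pi"] by (simp add: assms)
  have A: "J0 - J1 = 2*pi*r\<^sup>2"
    using has_integral_unique[OF rho_integrals(4)] has_integral_mult_left[OF L_has_integral, of r]
    by (simp add: assms L power2_eq_square)
  show "J2 - J1 = 0" using R A by simp
  have "p1 x + p3 x = 0" for x
  proof -
    have "(rho has_real_derivative (p1 x + p3 x)) (at x)"
      unfolding rho_def by (intro derivative_intros d0 d2)
    moreover have "rho = (\<lambda>_. r)" using assms by auto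
    ultimately show ?thesis using DERIV_unique DERIV_const by metis
  qed
  then show "J1 - 2*J2 + J3 = 0"
    using has_integral_unique[OF rho_integrals(3), of 0] by simp
  show "L = 2*pi*r" "J0 - 2*J1 + J2 = 2*pi*r\<^sup>2" "J0 - J1 = 2*pi*r\<^sup>2" by fact+
qed

end

section \<open>The support function of a smooth oval\<close>

definition normal_vec :: "real \<Rightarrow> real^2" where
  "normal_vec \<theta> = vector [- sin \<theta>, cos \<theta>]"

lemma unit_vec_nth [simp]: "unit_vec \<theta> $ 1 = cos \<theta>" "unit_vec \<theta> $ 2 = sin \<theta>"
  and normal_vec_nth [simp]: "normal_vec \<theta> $ 1 = - sin \<theta>" "normal_vec \<theta> $ 2 = cos \<theta>"
  by (simp_all add: unit_vec_def normal_vec_def)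

lemma inner_real2: "x \<bullet> y = x$1 * y$1 + x$2 * y$2" for x y :: "real^2"
  by (simp add: inner_vec_def sum_2)

lemma inner_unit_vec: "x \<bullet> unit_vec \<theta> = x$1 * cos \<theta> + x$2 * sin \<theta>"
  by (simp add: inner_real2)

lemma norm_unit_vec [simp]: "norm (unit_vec \<theta>) = 1"
  by (simp add: norm_eq_sqrt_inner inner_real2 flip: power2_eq_square)

lemma unit_vec_periodic [simp]: "unit_vec (\<theta> + 2*pi) = unit_vec \<theta>"
  by (simp add: unit_vec_def)

lemma polar_decomposition:
  fixes v :: "real^2"
  obtains \<theta> where "0 \<le> \<theta>" "\<theta> < 2*pi" "v = norm v *\<^sub>R unit_vec \<theta>"
proof (cases "v = 0")
  case True
  then show thesis using that[of 0] by simp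
next
  case False
  then have n: "norm v > 0" by simp
  have "(v$1)\<^sup>2 + (v$2)\<^sup>2 = (norm v)\<^sup>2"
    unfolding power2_norm_eq_inner inner_real2 by (simp only: power2_eq_square)
  then have "(v$1 / norm v)\<^sup>2 + (v$2 / norm v)\<^sup>2 = 1"
    using n by (simp add: power_divide flip: add_divide_distrib)
  from sincos_total_2pi[OF this]
  obtain t where t: "0 \<le> t" "t < 2*pi" "v$1 / norm v = cos t" "v$2 / norm v = sin t" .
  then have "v = norm v *\<^sub>R unit_vec t"
    using n by (simp add: vec_eq_iff forall_2 t(3,4)[symmetric])
  with t show thesis using that by blast
qed

text \<open>If \<open>c > 0\<close>, then \<open>f'\<close> would be positive immediately after \<open>t\<close>.\<close>

lemma second_derivative_at_max:
  fixes f :: "real \<Rightarrow> real"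
  assumes f: "\<And>t. (f has_real_derivative f' t) (at t)"
    and f': "(f' has_real_derivative c) (at t)" and max: "\<And>s. f s \<le> f t"
  shows "f' t = 0" "c \<le> 0"
proof -
  show 0: "f' t = 0" using DERIV_local_max[OF f, of 1 t] max by simp
  show "c \<le> 0"
  proof (rule ccontr)
    assume "\<not> c \<le> 0"
    then obtain d where d: "d > 0" "\<And>h. 0 < h \<Longrightarrow> h < d \<Longrightarrow> f' t < f' (t + h)"
      using DERIV_pos_inc_right[OF f'] by (meson not_le)
    have "f t < f (t + d/2)"
    proof (rule DERIV_pos_imp_increasing_open[where f = f and a = t and b = "t + d/2"])
      fix s assume "t < s" "s < t + d/2"
      then have "f' s > 0" using d(2)[of "s - t"] d(1) 0 by simp
      then show "\<exists>y. (f has_real_derivative y) (at s) \<and> 0 < y" using f by blast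
    qed (use d f in \<open>auto intro: DERIV_continuous_on has_field_derivative_at_within\<close>)
    then show False using max[of "t + d/2"] by simp
  qed
qed

lemma velocity_periodic:
  assumes c: "\<And>t. c (t + 1) = c t"
  shows "velocity c (t + 1) = velocity c t"
proof -
  have shift: "(c has_vector_derivative v) (at t)"
    if "(c has_vector_derivative v) (at (t + s))" "\<And>t. c (t + s) = c t" for v t s
  proof -
    have "((\<lambda>x. x + s) has_vector_derivative 1) (at t)"
      by (auto intro!: derivative_eq_intros)
    from vector_diff_chain_at[OF this that(1)] show ?thesis by (simp add: o_def that(2))
  qed
  have "c (t - 1) = c t" for t using c[of "t - 1"] by simp
  then have "(c has_vector_derivative v) (at (t + 1)) \<longleftrightarrow> (c has_vector_derivative v) (at t)" for v
    using shift[of v t 1] shift[of v "t + 1" "-1"] c by auto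
  then show ?thesis by (simp add: velocity_def vector_derivative_def)
qed

lemma smooth_curve_component:
  assumes "smooth_curve c"
  shows "((\<lambda>t. (velocity ^^ n) c t $ i) has_real_derivative (velocity ^^ Suc n) c t $ i) (at t)"
proof -
  have "(velocity ^^ n) c differentiable (at t)" using assms by (simp add: smooth_curve_def)
  then have "((velocity ^^ n) c has_vector_derivative (velocity ^^ Suc n) c t) (at t)"
    by (simp add: vector_derivative_works velocity_def)
  from bounded_linear.has_vector_derivative[OF bounded_linear_vec_nth this]
  show ?thesis by (simp add: has_real_derivative_iff_has_vector_derivative)
qed

locale convex_oval =
  fixes K :: "(real^2) set" and \<gamma> :: "real \<Rightarrow> real^2"
  assumes K: "strictly_convex_domain_enclosed_by K \<gamma>"
begin

lemma compact: "compact K" and interior: "interior K \<noteq> {}" and smooth: "smooth_curve \<gamma>"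
  and periodic: "\<gamma> (t + 1) = \<gamma> t" and regular: "velocity \<gamma> t \<noteq> 0"
  and image: "path_image \<gamma> = frontier K" and curvature: "signed_curvature \<gamma> t > 0"
  using K by (auto simp: strictly_convex_domain_enclosed_by_def smooth_closed_curve_def)

lemma convex: "convex K"
  unfolding convex_contains_open_segment
proof (intro ballI)
  show "open_segment x y \<subseteq> K" if "x \<in> K" "y \<in> K" for x y
  proof (cases "x = y")
    case False
    then have "open_segment x y \<subseteq> interior K"
      using K that by (simp add: strictly_convex_domain_enclosed_by_def strictly_convex_def)
    then show ?thesis using interior_subset by blast
  qed simp
qed

definition x where "x t = \<gamma> t $ 1"
definition x' where "x' t = velocity \<gamma> t $ 1"
definition x'' where "x'' t = velocity (velocity \<gamma>) t $ 1"
definition x''' where "x''' t = velocity (velocity (velocity \<gamma>)) t $ 1"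
definition y where "y t = \<gamma> t $ 2"
definition y' where "y' t = velocity \<gamma> t $ 2"
definition y'' where "y'' t = velocity (velocity \<gamma>) t $ 2"
definition y''' where "y''' t = velocity (velocity (velocity \<gamma>)) t $ 2"

lemmas xy_defs = x_def x'_def x''_def x'''_def y_def y'_def y''_def y'''_def

lemma xy_derivs:
  "(x has_real_derivative x' t) (at t)" "(x' has_real_derivative x'' t) (at t)"
  "(x'' has_real_derivative x''' t) (at t)"
  "(y has_real_derivative y' t) (at t)" "(y' has_real_derivative y'' t) (at t)"
  "(y'' has_real_derivative y''' t) (at t)"
  using smooth_curve_component[OF smooth, of 0] smooth_curve_component[OF smooth, of 1]
    smooth_curve_component[OF smooth, of 2]
  unfolding xy_defs by (simp_all add: numeral_2_eq_2)

lemma xy_conts: "continuous_on S x" "continuous_on S x'" "continuous_on S x''" "continuous_on S x'''"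
  "continuous_on S y" "continuous_on S y'" "continuous_on S y''" "continuous_on S y'''"
proof -
  have c: "continuous_on S f" if "\<And>t. (f has_real_derivative f' t) (at t)" for f f' :: "real \<Rightarrow> real"
    by (rule DERIV_continuous_on) (rule has_field_derivative_at_within[OF that])
  show "continuous_on S x" "continuous_on S x'" "continuous_on S x''"
    "continuous_on S y" "continuous_on S y'" "continuous_on S y''"
    by (rule c, rule xy_derivs)+
  show "continuous_on S x'''" "continuous_on S y'''"
    using c[OF smooth_curve_component[OF smooth, of 3 1]] c[OF smooth_curve_component[OF smooth, of 3 2]]
    by (simp_all add: xy_defs numeral_3_eq_3)
qed

definition speed2 where "speed2 t = (x' t)\<^sup>2 + (y' t)\<^sup>2"
definition cross where "cross t = x' t * y'' t - y' t * x'' t"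

text \<open>The derivative of the tangent angle with respect to the parameter of the curve (not to arclength).\<close>

definition turning_rate where "turning_rate t = cross t / speed2 t"

lemma speed2_pos: "speed2 t > 0"
proof -
  have "x' t \<noteq> 0 \<or> y' t \<noteq> 0" using regular[of t] by (auto simp: xy_defs vec_eq_iff forall_2)
  then show ?thesis unfolding speed2_def by (meson sum_power2_gt_zero_iff)
qed

lemma cross_pos: "cross t > 0"
proof -
  have "norm (velocity \<gamma> t) ^ 3 > 0" using regular by simp
  then show ?thesis using curvature[of t] 
    by (simp add: signed_curvature_def cross_def xy_defs zero_less_divide_iff)
qed

lemma turning_rate_pos: "turning_rate t > 0"
  using speed2_pos cross_pos by (simp add: turning_rate_def)

text \<open>The path image only covers one period of the parametrization.\<close>

lemma curve_in_frontier: "\<gamma> s \<in> frontier K"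
proof -
  have shift: "\<gamma> (r + of_nat n) = \<gamma> r" for r n
    by (induction n) (simp_all add: periodic flip: add.assoc add: add.commute[of 1])
  have "\<gamma> (frac s) = \<gamma> s"
  proof (cases "\<lfloor>s\<rfloor> \<ge> 0")
    case True
    then show ?thesis using shift[of "frac s" "nat \<lfloor>s\<rfloor>"] by (simp add: frac_def)
  next
    case False
    then show ?thesis using shift[of s "nat (- \<lfloor>s\<rfloor>)"] by (simp add: frac_def)
  qed
  moreover have "frac s \<in> {0..1}" by (simp add: frac_ge_0 less_imp_le[OF frac_lt_1])
  ultimately show ?thesis unfolding image[symmetric] path_image_def by (metis imageI)
qed

text \<open>The first-order condition at a maximum makes the velocity tangential, \<open>\<gamma>' = l (-sin \<phi>, cos \<phi>)\<close>. The
  second-order condition and the positive curvature then give \<open>l > 0\<close>: the curve runs counterclockwise.\<close>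

lemma normal_at_support_point:
  assumes max: "\<And>z. z \<in> K \<Longrightarrow> z \<bullet> unit_vec \<phi> \<le> \<gamma> t \<bullet> unit_vec \<phi>"
  shows "x' t = - sqrt (speed2 t) * sin \<phi>" "y' t = sqrt (speed2 t) * cos \<phi>"
proof -
  let ?f = "\<lambda>t. x t * cos \<phi> + y t * sin \<phi>"
  have "?f s \<le> ?f t" for s
  proof -
    have "\<gamma> s \<in> K" using curve_in_frontier compact compact_imp_closed frontier_subset_closed by blast
    from max[OF this] show ?thesis by (simp add: inner_unit_vec x_def y_def)
  qed
  moreover have "(?f has_real_derivative (x' t * cos \<phi> + y' t * sin \<phi>)) (at t)" for t
    by (auto intro!: derivative_eq_intros xy_derivs)
  moreover have "((\<lambda>t. x' t * cos \<phi> + y' t * sin \<phi>) has_real_derivative (x'' t * cos \<phi> + y'' t * sin \<phi>)) (at t)"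
    by (auto intro!: derivative_eq_intros xy_derivs)
  ultimately have 1: "x' t * cos \<phi> + y' t * sin \<phi> = 0" and 2: "x'' t * cos \<phi> + y'' t * sin \<phi> \<le> 0"
    using second_derivative_at_max[where f = ?f and f' = "\<lambda>t. x' t * cos \<phi> + y' t * sin \<phi>"] by blast+
  define l where "l = y' t * cos \<phi> - x' t * sin \<phi>"
  have sc: "(sin \<phi>)\<^sup>2 + (cos \<phi>)\<^sup>2 = 1" by simp
  have xl: "x' t = - l * sin \<phi>" unfolding l_def using 1 sc by algebra
  have yl: "y' t = l * cos \<phi>" unfolding l_def using 1 sc by algebra
  have "cross t = - l * (x'' t * cos \<phi> + y'' t * sin \<phi>)"
    unfolding cross_def xl yl by (simp add: algebra_simps)
  then have "l * (x'' t * cos \<phi> + y'' t * sin \<phi>) < 0" using cross_pos[of t] by simp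
  then have "l > 0" using 2 by (simp add: mult_less_0_iff)
  moreover have "speed2 t = l\<^sup>2" unfolding speed2_def xl yl using sc by algebra
  ultimately have "sqrt (speed2 t) = l" by simp
  then show "x' t = - sqrt (speed2 t) * sin \<phi>" "y' t = sqrt (speed2 t) * cos \<phi>" using xl yl by simp_all
qed

end

lemma antiderivative_real:
  fixes f :: "real \<Rightarrow> real"
  assumes "continuous_on UNIV f"
  obtains F where "\<And>t. (F has_real_derivative f t) (at t)"
proof -
  have "\<exists>F. \<forall>t::real. -\<infinity> < ereal t \<longrightarrow> ereal t < \<infinity> \<longrightarrow> (F has_vector_derivative f t) (at t)"
    using assms by (intro einterval_antiderivative) (auto simp: continuous_on_eq_continuous_at)
  then show thesis using that by (auto simp: has_real_derivative_iff_has_vector_derivative)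
qed

context convex_oval
begin

lemma turning_rate_cont: "continuous_on S turning_rate"
proof -
  have "speed2 t \<noteq> 0" for t using speed2_pos[of t] by simp
  then show ?thesis unfolding turning_rate_def[abs_def] cross_def speed2_def by (intro continuous_intros xy_conts) simp
qed

lemma angle_exists:
  "\<exists>\<theta>. (\<forall>t. (\<theta> has_real_derivative turning_rate t) (at t)) \<and>
     x' 0 = - sqrt (speed2 0) * sin (\<theta> 0) \<and> y' 0 = sqrt (speed2 0) * cos (\<theta> 0)"
proof -
  let ?v = "vector [y' 0, - x' 0] :: real^2"
  obtain \<phi> where \<phi>: "?v = norm ?v *\<^sub>R unit_vec \<phi>" using polar_decomposition by metis
  have n: "norm ?v = sqrt (speed2 0)"
    by (simp add: norm_eq_sqrt_inner inner_real2 speed2_def power2_eq_square)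
  have "y' 0 = sqrt (speed2 0) * cos \<phi>" "- x' 0 = sqrt (speed2 0) * sin \<phi>"
    using arg_cong[OF \<phi>, of "\<lambda>v. v $ 1"] arg_cong[OF \<phi>, of "\<lambda>v. v $ 2"] unfolding n by simp_all
  moreover obtain F where F: "\<And>t. (F has_real_derivative turning_rate t) (at t)"
    using antiderivative_real[OF turning_rate_cont] by blast
  have "((\<lambda>t. F t - F 0 + \<phi>) has_real_derivative turning_rate t) (at t)" for t
    by (auto intro!: derivative_eq_intros F)
  ultimately show ?thesis by (intro exI[of _ "\<lambda>t. F t - F 0 + \<phi>"]) auto
qed

text \<open>A continuous choice of the normal angle along the curve: an antiderivative of the turning rate that
  starts at the right value.\<close>

definition angle :: "real \<Rightarrow> real" where
  "angle = (SOME \<theta>. (\<forall>t. (\<theta> has_real_derivative turning_rate t) (at t)) \<and>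
     x' 0 = - sqrt (speed2 0) * sin (\<theta> 0) \<and> y' 0 = sqrt (speed2 0) * cos (\<theta> 0))"

lemma angle_deriv: "(angle has_real_derivative turning_rate t) (at t)"
  and angle_0: "x' 0 = - sqrt (speed2 0) * sin (angle 0)" "y' 0 = sqrt (speed2 0) * cos (angle 0)"
  using someI_ex[OF angle_exists] unfolding angle_def[symmetric] by auto

lemma angle_cont: "continuous_on S angle"
  by (rule DERIV_continuous_on) (rule has_field_derivative_at_within[OF angle_deriv])

text \<open>The velocity and the unit tangent with angle \<open>angle\<close> rotate at the same rate. Hence the squared cosine
  \<open>g\<^sup>2 / \<bar>\<gamma>'\<bar>\<^sup>2\<close> of the angle between the velocity and the expected normal has derivative zero, and it is zero
  at the start. So the velocity is always tangential, and by continuity it never reverses.\<close>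

lemma angle_tangent:
  "x' t = - sqrt (speed2 t) * sin (angle t)" "y' t = sqrt (speed2 t) * cos (angle t)"
proof -
  define g where "g t = x' t * cos (angle t) + y' t * sin (angle t)" for t
  define a where "a t = y' t * cos (angle t) - x' t * sin (angle t)" for t
  define X where "X t = x'' t * cos (angle t) + y'' t * sin (angle t)" for t
  have g: "(g has_real_derivative X t + turning_rate t * a t) (at t)" for t
    unfolding g_def X_def a_def
    by (auto intro!: derivative_eq_intros xy_derivs angle_deriv simp: algebra_simps)
  have v: "(speed2 has_real_derivative 2 * (x' t * x'' t + y' t * y'' t)) (at t)" for t
    unfolding speed2_def by (auto intro!: derivative_eq_intros xy_derivs simp: algebra_simps)
  have key: "(X t + turning_rate t * a t) * speed2 t = g t * (x' t * x'' t + y' t * y'' t)" for t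
  proof -
    have "(X t + turning_rate t * a t) * speed2 t = X t * speed2 t + cross t * a t"
      using speed2_pos[of t] by (simp add: turning_rate_def distrib_right)
    also have "\<dots> = g t * (x' t * x'' t + y' t * y'' t)"
      unfolding X_def a_def g_def cross_def speed2_def by algebra
    finally show ?thesis .
  qed
  have "((\<lambda>t. (g t)\<^sup>2 / speed2 t) has_real_derivative 0) (at t)" for t
  proof -
    have "((\<lambda>t. (g t)\<^sup>2 / speed2 t) has_real_derivative
       (2 * g t * (X t + turning_rate t * a t) * speed2 t - (g t)\<^sup>2 * (2 * (x' t * x'' t + y' t * y'' t))) / (speed2 t * speed2 t)) (at t)"
      using speed2_pos[of t] by (auto intro!: derivative_eq_intros g v)
    also have "2 * g t * (X t + turning_rate t * a t) * speed2 t - (g t)\<^sup>2 * (2 * (x' t * x'' t + y' t * y'' t)) = 0"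
      using key[of t] by algebra
    finally show ?thesis by simp
  qed
  then have "(g t)\<^sup>2 / speed2 t = (g 0)\<^sup>2 / speed2 0" for t
    using DERIV_isconst_all by blast
  moreover have "g 0 = 0" by (simp add: g_def angle_0)
  ultimately have "(g t)\<^sup>2 / speed2 t = 0" for t by simp
  then have g0: "g t = 0" for t using speed2_pos[of t] by (metis divide_eq_0_iff less_irrefl power_eq_0_iff)
  have sc: "(sin (angle t))\<^sup>2 + (cos (angle t))\<^sup>2 = 1" for t by simp
  have a2: "(a t)\<^sup>2 = speed2 t" for t
    using g0[of t] sc[of t] unfolding a_def g_def speed2_def by algebra
  have a0: "a 0 > 0"
  proof -
    have "a 0 = sqrt (speed2 0) * ((sin (angle 0))\<^sup>2 + (cos (angle 0))\<^sup>2)"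
      unfolding a_def angle_0 by algebra
    then show ?thesis using speed2_pos[of 0] by simp
  qed
  have ca: "continuous_on S a" for S
    unfolding a_def by (intro continuous_intros xy_conts angle_cont)
  have ane: "a t \<noteq> 0" for t using a2[of t] speed2_pos[of t] by auto
  have "a t > 0"
  proof (rule ccontr)
    assume "\<not> a t > 0"
    then have "a t \<le> 0" by simp
    then obtain s where "a s = 0"
      using IVT'[of a t 0 0] IVT2'[of a t 0 0] a0 ca by (cases "t \<le> 0") (auto simp: less_imp_le)
    then show False using ane by blast
  qed
  then have sqrt: "sqrt (speed2 t) = a t"
    by (intro real_sqrt_unique a2) simp
  have "x' t * cos (angle t) + y' t * sin (angle t) = 0" using g0[of t] by (simp add: g_def)
  then show "x' t = - sqrt (speed2 t) * sin (angle t)" "y' t = sqrt (speed2 t) * cos (angle t)"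
    unfolding sqrt a_def using sc[of t] by algebra+
qed

lemma angle_strict_mono: "strict_mono angle"
proof (rule strict_monoI)
  show "angle s < angle t" if "s < t" for s t
    using that by (rule DERIV_pos_imp_increasing) (use angle_deriv turning_rate_pos in blast)
qed

lemma turning_rate_periodic: "turning_rate (t + 1) = turning_rate t"
proof -
  have 1: "velocity \<gamma> (t + 1) = velocity \<gamma> t" for t by (rule velocity_periodic[where c = \<gamma>, OF periodic])
  from velocity_periodic[where c = "velocity \<gamma>", OF this]
  have 2: "velocity (velocity \<gamma>) (t + 1) = velocity (velocity \<gamma>) t" for t .
  show ?thesis by (simp add: turning_rate_def cross_def speed2_def xy_defs 1 2)
qed

text \<open>Since the turning rate has period 1, the angle grows by the same positive amount over each period.\<close>

lemma surj_angle: "surj angle"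
proof -
  define d where "d = angle 1 - angle 0"
  have d: "d > 0" using strict_monoD[OF angle_strict_mono, of 0 1] by (simp add: d_def)
  have der: "((\<lambda>t. angle (t + 1) - angle t) has_real_derivative 0) (at t)" for t
  proof -
    have "((\<lambda>t. angle (t + 1)) has_real_derivative turning_rate (t + 1) * 1) (at t)"
      by (rule DERIV_chain2[OF angle_deriv]) (auto intro!: derivative_eq_intros)
    from DERIV_diff[OF this angle_deriv[of t]] show ?thesis by (simp add: turning_rate_periodic)
  qed
  have step: "angle (t + 1) = angle t + d" for t
    using DERIV_isconst_all[of "\<lambda>t. angle (t + 1) - angle t" t 0] der by (simp add: d_def)
  have up: "angle (real n) = angle 0 + real n * d" for n
  proof (induction n)
    case (Suc n)
    then show ?case using step[of "real n"] by (simp add: algebra_simps)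
  qed simp
  have down: "angle (- real n) = angle 0 - real n * d" for n
  proof (induction n)
    case (Suc n)
    have "angle (- real (Suc n) + 1) = angle (- real n)" by simp
    then show ?case using step[of "- real (Suc n)"] Suc by (simp add: algebra_simps)
  qed simp
  have "\<exists>t. angle t = \<phi>" for \<phi>
  proof -
    obtain n where n: "\<bar>\<phi> - angle 0\<bar> < real n * d" using d reals_Archimedean3 by blast
    have "\<exists>t\<ge>- real n. t \<le> real n \<and> angle t = \<phi>"
      using n by (intro IVT' angle_cont) (auto simp: up down)
    then show ?thesis by blast
  qed
  then show ?thesis by (metis surjI)
qed

text \<open>The parameter at which the curve has a given normal angle.\<close>

definition time :: "real \<Rightarrow> real" where "time = inv angle"

lemma angle_time [simp]: "angle (time \<phi>) = \<phi>"
  unfolding time_def by (rule surj_f_inv_f[OF surj_angle])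

lemma time_angle [simp]: "time (angle t) = t"
  unfolding time_def by (rule inv_f_f[OF strict_mono_imp_inj_on[OF angle_strict_mono]])

lemma time_has_derivative: "(time has_real_derivative inverse (turning_rate (time \<phi>))) (at \<phi>)"
proof (rule DERIV_inverse_function[where f = angle and a = "\<phi> - 1" and b = "\<phi> + 1"])
  show "(angle has_real_derivative turning_rate (time \<phi>)) (at (time \<phi>))" by (rule angle_deriv)
  show "turning_rate (time \<phi>) \<noteq> 0" using turning_rate_pos[of "time \<phi>"] by simp
  have "isCont time (angle (time \<phi>))"
    by (rule isCont_inverse_function[where d = 1]) (auto intro: DERIV_isCont angle_deriv)
  then show "isCont time \<phi>" by simp
qed auto

text \<open>A convex set has a supporting line at each boundary point. By \<open>normal_at_support_point\<close> its normal can
  only be that of the curve.\<close>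

lemma curve_supports:
  assumes "z \<in> K"
  shows "z \<bullet> unit_vec (angle t) \<le> \<gamma> t \<bullet> unit_vec (angle t)"
proof -
  have clK: "closure K = K" using compact compact_imp_closed closure_closed by blast
  have ri: "rel_interior K = interior K" by (rule rel_interior_nonempty_interior[OF interior])
  have "\<gamma> t \<in> closure K" "\<gamma> t \<notin> rel_interior K"
    using curve_in_frontier[of t] by (auto simp: frontier_def ri)
  from supporting_hyperplane_relative_frontier[OF convex this]
  obtain a where a: "a \<noteq> 0" "\<And>z. z \<in> K \<Longrightarrow> a \<bullet> \<gamma> t \<le> a \<bullet> z"
    using clK by metis
  obtain \<phi> where \<phi>: "- a = norm (- a) *\<^sub>R unit_vec \<phi>" using polar_decomposition by metis
  have max: "z \<bullet> unit_vec \<phi> \<le> \<gamma> t \<bullet> unit_vec \<phi>" if "z \<in> K" for z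
  proof -
    have "(- a) \<bullet> z \<le> (- a) \<bullet> \<gamma> t" using a(2)[OF that] by simp
    then have "norm (- a) * (unit_vec \<phi> \<bullet> z) \<le> norm (- a) * (unit_vec \<phi> \<bullet> \<gamma> t)"
      by (subst (asm) (1 2) \<phi>) simp
    then show ?thesis using a(1) by (simp add: inner_commute)
  qed
  have s: "sqrt (speed2 t) > 0" using speed2_pos by simp
  have "sin \<phi> = sin (angle t)" "cos \<phi> = cos (angle t)"
    using normal_at_support_point[OF max] angle_tangent[of t] s by simp_all
  then have "unit_vec \<phi> = unit_vec (angle t)" by (simp add: unit_vec_def)
  then show ?thesis using max[OF assms] by simp
qed

abbreviation p :: "real \<Rightarrow> real" where "p \<equiv> support_fun K"

lemma support_fun_time: "p \<phi> = \<gamma> (time \<phi>) \<bullet> unit_vec \<phi>"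
  unfolding support_fun_def
proof (rule cSup_eq_maximum)
  have "\<gamma> (time \<phi>) \<in> K"
    using curve_in_frontier compact compact_imp_closed frontier_subset_closed by blast
  then show "\<gamma> (time \<phi>) \<bullet> unit_vec \<phi> \<in> (\<lambda>x. x \<bullet> unit_vec \<phi>) ` K" by blast
  show "a \<le> \<gamma> (time \<phi>) \<bullet> unit_vec \<phi>" if "a \<in> (\<lambda>x. x \<bullet> unit_vec \<phi>) ` K" for a
    using that curve_supports[of _ "time \<phi>"] by auto
qed

definition p1 where "p1 \<phi> = \<gamma> (time \<phi>) \<bullet> normal_vec \<phi>"
definition radius where "radius t = sqrt (speed2 t) / turning_rate t"

text \<open>The quotient rule applied to \<open>radius\<close>, spelled out in the derivatives of the coordinates up to the
  third. It is therefore visibly continuous.\<close>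

definition radius' where
  "radius' t = ((x' t * x'' t + y' t * y'' t) / sqrt (speed2 t) * turning_rate t -
     sqrt (speed2 t) * (((x' t * y''' t - y' t * x''' t) * speed2 t -
       cross t * (2 * (x' t * x'' t + y' t * y'' t))) / (speed2 t)\<^sup>2)) / (turning_rate t)\<^sup>2"
definition p2 where "p2 \<phi> = radius (time \<phi>) - p \<phi>"
definition p3 where "p3 \<phi> = radius' (time \<phi>) * inverse (turning_rate (time \<phi>)) - p1 \<phi>"

lemma radius_deriv: "(radius has_real_derivative radius' t) (at t)"
proof -
  have v: "(speed2 has_real_derivative 2 * (x' t * x'' t + y' t * y'' t)) (at t)"
    unfolding speed2_def by (auto intro!: derivative_eq_intros xy_derivs simp: algebra_simps)
  have c: "(cross has_real_derivative x' t * y''' t - y' t * x''' t) (at t)"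
    unfolding cross_def by (auto intro!: derivative_eq_intros xy_derivs simp: algebra_simps)
  have k: "(turning_rate has_real_derivative ((x' t * y''' t - y' t * x''' t) * speed2 t -
       cross t * (2 * (x' t * x'' t + y' t * y'' t))) / (speed2 t)\<^sup>2) (at t)"
    unfolding turning_rate_def[abs_def] using speed2_pos[of t] DERIV_divide[OF c v] by (simp add: power2_eq_square)
  have s: "((\<lambda>t. sqrt (speed2 t)) has_real_derivative (x' t * x'' t + y' t * y'' t) / sqrt (speed2 t)) (at t)"
    using speed2_pos[of t] by (auto intro!: derivative_eq_intros v simp: field_simps)
  show ?thesis
    unfolding radius_def[abs_def] radius'_def using turning_rate_pos[of t] DERIV_divide[OF s k]
    by (simp add: power2_eq_square)
qed

lemma radius'_cont: "continuous_on S radius'"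
proof -
  have "speed2 t \<noteq> 0" "turning_rate t \<noteq> 0" for t using speed2_pos[of t] turning_rate_pos[of t] by simp_all
  then show ?thesis unfolding radius'_def[abs_def]
    by (intro continuous_intros xy_conts turning_rate_cont) (auto simp: speed2_def[abs_def] cross_def[abs_def]  intro!: continuous_intros xy_conts)
qed

lemma time_cont: "continuous_on S time"
  by (rule DERIV_continuous_on) (rule has_field_derivative_at_within[OF time_has_derivative])

lemma xy_time_derivs:
  "((\<lambda>\<phi>. x (time \<phi>)) has_real_derivative - radius (time \<phi>) * sin \<phi>) (at \<phi>)"
  "((\<lambda>\<phi>. y (time \<phi>)) has_real_derivative radius (time \<phi>) * cos \<phi>) (at \<phi>)"
  using DERIV_chain2[OF xy_derivs(1) time_has_derivative[of \<phi>]] DERIV_chain2[OF xy_derivs(4) time_has_derivative[of \<phi>]]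
  by (simp_all add: angle_tangent radius_def divide_inverse mult_ac)

sublocale periodic_C3 p p1 p2 p3
proof unfold_locales
  have p: "p = (\<lambda>\<phi>. x (time \<phi>) * cos \<phi> + y (time \<phi>) * sin \<phi>)"
    by (simp add: fun_eq_iff support_fun_time inner_unit_vec x_def y_def)
  have p1: "p1 = (\<lambda>\<phi>. y (time \<phi>) * cos \<phi> - x (time \<phi>) * sin \<phi>)"
    by (simp add: fun_eq_iff p1_def inner_real2 x_def y_def)
  show d0: "(p has_real_derivative p1 \<phi>) (at \<phi>)" for \<phi>
    unfolding p p1 by (auto intro!: derivative_eq_intros xy_time_derivs)
  show d1: "(p1 has_real_derivative p2 \<phi>) (at \<phi>)" for \<phi>
  proof -
    have "(p1 has_real_derivative radius (time \<phi>) * cos \<phi> * cos \<phi> - y (time \<phi>) * sin \<phi>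
        - (- radius (time \<phi>) * sin \<phi> * sin \<phi> + x (time \<phi>) * cos \<phi>)) (at \<phi>)"
      unfolding p1 by (auto intro!: derivative_eq_intros xy_time_derivs simp: algebra_simps)
    also have "radius (time \<phi>) * cos \<phi> * cos \<phi> - y (time \<phi>) * sin \<phi>
        - (- radius (time \<phi>) * sin \<phi> * sin \<phi> + x (time \<phi>) * cos \<phi>) = p2 \<phi>"
      unfolding p2_def p using sin_cos_squared_add[of \<phi>] by algebra
    finally show ?thesis .
  qed
  show "(p2 has_real_derivative p3 \<phi>) (at \<phi>)" for \<phi>
    unfolding p2_def[abs_def] p3_def
    by (intro derivative_intros d0 DERIV_chain2[OF radius_deriv time_has_derivative])
  have "turning_rate (time \<phi>) \<noteq> 0" for \<phi> using turning_rate_pos[of "time \<phi>"] by simp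
  then show "continuous_on UNIV p3"
    unfolding p3_def[abs_def] using DERIV_continuous_on[OF has_field_derivative_at_within[OF d1]]
    by (intro continuous_intros continuous_on_compose2[OF radius'_cont time_cont]
        continuous_on_compose2[OF turning_rate_cont time_cont]) auto
  show "p (\<phi> + 2*pi) = p \<phi>" for \<phi> by (simp add: support_fun_def)
qed

lemma rho_pos: "rho \<phi> > 0"
  using speed2_pos[of "time \<phi>"] turning_rate_pos[of "time \<phi>"] by (simp add: rho_def p2_def radius_def)

text \<open>The curve parametrized by its normal angle, expressed by \<open>p\<close> and \<open>p1\<close> alone so that its periodicity is
  visible.\<close>

definition support_point :: "real \<Rightarrow> real^2" where
  "support_point \<phi> = p \<phi> *\<^sub>R unit_vec \<phi> + p1 \<phi> *\<^sub>R normal_vec \<phi>"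

lemma support_point_time: "support_point \<phi> = \<gamma> (time \<phi>)"
proof -
  have sc: "(sin \<phi>)\<^sup>2 + (cos \<phi>)\<^sup>2 = 1" by simp
  have "support_point \<phi> $ 1 = \<gamma> (time \<phi>) $ 1"
    by (simp add: support_point_def p1_def support_fun_time inner_real2, use sc in algebra)
  moreover have "support_point \<phi> $ 2 = \<gamma> (time \<phi>) $ 2"
    by (simp add: support_point_def p1_def support_fun_time inner_real2, use sc in algebra)
  ultimately show ?thesis by (simp add: vec_eq_iff forall_2)
qed

lemma support_point_shift: "support_point (\<phi> + 2*pi * of_int k) = support_point \<phi>"
proof -
  have 1: "support_point (\<phi> + 2*pi) = support_point \<phi>" for \<phi>
    by (simp add: support_point_def P0.periodic P1.periodic normal_vec_def)
  have nat: "support_point (\<phi> + 2*pi * real n) = support_point \<phi>" for \<phi> n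
    by (induction n) (use 1[of "\<phi> + 2*pi * real _"] in \<open>simp_all add: algebra_simps\<close>)
  show ?thesis
  proof (cases "k \<ge> 0")
    case True
    then show ?thesis using nat[of \<phi> "nat k"] by simp
  next
    case False
    then show ?thesis using nat[of "\<phi> + 2*pi * of_int k" "nat (- k)"] by simp
  qed
qed

lemma frontier_eq: "support_point ` {0..<2*pi} = frontier K"
proof
  show "support_point ` {0..<2*pi} \<subseteq> frontier K"
    using curve_in_frontier by (auto simp: support_point_time)
  show "frontier K \<subseteq> support_point ` {0..<2*pi}"
  proof
    fix z assume "z \<in> frontier K"
    then obtain t where "z = \<gamma> t" using image by (auto simp: path_image_def)
    then have z: "z = support_point (angle t)" by (simp add: support_point_time)
    let ?k = "\<lfloor>angle t / (2*pi)\<rfloor>"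
    have "z = support_point (angle t + 2*pi * of_int (- ?k))" using z support_point_shift by metis
    moreover have "angle t + 2*pi * of_int (- ?k) = 2*pi * frac (angle t / (2*pi))"
      by (simp add: frac_def algebra_simps)
    moreover have "2*pi * frac (angle t / (2*pi)) \<in> {0..<2*pi}"
      using frac_lt_1[of "angle t / (2*pi)"] by (simp add: frac_ge_0)
    ultimately show "z \<in> support_point ` {0..<2*pi}" by (metis imageI)
  qed
qed

text \<open>A boundary point of a smooth curve determines its normal.\<close>

lemma inj_support_point: "inj_on support_point {0..<2*pi}"
proof (rule inj_onI)
  fix \<phi> \<psi> assume \<phi>\<psi>: "\<phi> \<in> {0..<2*pi}" "\<psi> \<in> {0..<2*pi}" and eq: "support_point \<phi> = support_point \<psi>"
  let ?t = "time \<phi>"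
  have max: "z \<bullet> unit_vec \<psi> \<le> \<gamma> ?t \<bullet> unit_vec \<psi>" if "z \<in> K" for z
    using curve_supports[OF that, of "time \<psi>"] eq by (simp add: support_point_time)
  have "sqrt (speed2 ?t) > 0" using speed2_pos by simp
  then have "sin \<phi> = sin \<psi> \<and> cos \<phi> = cos \<psi>"
    using normal_at_support_point[OF max] angle_tangent[of ?t] by simp
  then obtain n :: int where n: "\<phi> = \<psi> + 2*pi * n" using sin_cos_eq_iff by blast
  then have "\<bar>2*pi * n\<bar> < 2*pi" using \<phi>\<psi> by auto
  then have "\<bar>real_of_int n\<bar> < 1" by (simp add: abs_mult)
  then show "\<phi> = \<psi>" using n by simp
qed

end

section \<open>Length, evolute area and area\<close>

lemma unit_vec_axis: "unit_vec \<theta> = cos \<theta> *\<^sub>R axis 1 1 + sin \<theta> *\<^sub>R axis 2 1"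
  and normal_vec_axis: "normal_vec \<theta> = (- sin \<theta>) *\<^sub>R axis 1 1 + cos \<theta> *\<^sub>R axis 2 1"
  by (simp_all add: vec_eq_iff forall_2 axis_def)

lemma unit_vec_deriv: "(unit_vec has_vector_derivative normal_vec \<theta>) (at \<theta>)"
  unfolding unit_vec_axis[abs_def] normal_vec_axis
  by (auto intro!: derivative_eq_intros)

lemma normal_vec_deriv: "(normal_vec has_vector_derivative - unit_vec \<theta>) (at \<theta>)"
  unfolding unit_vec_axis normal_vec_axis[abs_def]
  by (auto intro!: derivative_eq_intros)

context convex_oval
begin

lemma deriv_p: "deriv p = p1" and deriv_p1: "deriv p1 = p2" and deriv_p2: "deriv p2 = p3"
  by (auto simp: fun_eq_iff intro!: DERIV_imp_deriv d0 d1 d2)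

lemma curv_radius_eq: "curv_radius K = rho"
  by (simp add: fun_eq_iff curv_radius_def rho_def numeral_2_eq_2 deriv_p deriv_p1)

lemma evolute_curv_radius_eq: "evolute_curv_radius K \<phi> = \<bar>p1 \<phi> + p3 \<phi>\<bar>"
  by (simp add: evolute_curv_radius_def numeral_3_eq_3 deriv_p deriv_p1 deriv_p2)

lemma boundary_curve_eq: "boundary_curve K = support_point"
  by (simp add: fun_eq_iff boundary_curve_def Let_def deriv_p support_point_def vec_eq_iff forall_2)

lemma support_point_deriv:
  "(support_point has_vector_derivative rho \<phi> *\<^sub>R normal_vec \<phi>) (at \<phi>)"
proof -
  have "(support_point has_vector_derivative
      (p \<phi> *\<^sub>R normal_vec \<phi> + p1 \<phi> *\<^sub>R unit_vec \<phi>) + (p1 \<phi> *\<^sub>R (- unit_vec \<phi>) + p2 \<phi> *\<^sub>R normal_vec \<phi>)) (at \<phi>)"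
    unfolding support_point_def[abs_def]
    by (intro has_vector_derivative_add has_vector_derivative_scaleR d0 d1 unit_vec_deriv normal_vec_deriv)
  then show ?thesis by (simp add: rho_def algebra_simps)
qed

lemma boundary_length_eq: "boundary_length K = L"
proof -
  have n: "norm (normal_vec \<phi>) = 1" for \<phi>
    by (simp add: norm_eq_sqrt_inner inner_real2 flip: power2_eq_square)
  have "velocity (boundary_curve K) \<phi> = rho \<phi> *\<^sub>R normal_vec \<phi>" for \<phi>
    unfolding velocity_def boundary_curve_eq by (rule vector_derivative_at[OF support_point_deriv])
  then have "norm (velocity (boundary_curve K) \<phi>) = rho \<phi>" for \<phi>
    using rho_pos[of \<phi>] by (simp add: n)
  then show ?thesis
    unfolding boundary_length_def arc_integral_def using integral_unique[OF rho_integrals(1)] by simp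
qed

lemma evolute_area_eq: "evolute_area K = (J1 - J2) / 2"
proof -
  have ev: "evolute K = (\<lambda>\<phi>. p1 \<phi> *\<^sub>R normal_vec \<phi> - p2 \<phi> *\<^sub>R unit_vec \<phi>)"
    by (simp add: fun_eq_iff evolute_def boundary_curve_eq support_point_def curv_radius_eq rho_def algebra_simps)
  have "(evolute K has_vector_derivative
      (p1 \<phi> *\<^sub>R (- unit_vec \<phi>) + p2 \<phi> *\<^sub>R normal_vec \<phi>) - (p2 \<phi> *\<^sub>R normal_vec \<phi> + p3 \<phi> *\<^sub>R unit_vec \<phi>)) (at \<phi>)" for \<phi>
    unfolding ev
    by (intro has_vector_derivative_diff has_vector_derivative_scaleR d1 d2 unit_vec_deriv normal_vec_deriv)
  then have vel: "velocity (evolute K) \<phi> = - (p1 \<phi> + p3 \<phi>) *\<^sub>R unit_vec \<phi>" for \<phi>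
    by (subst velocity_def, subst vector_derivative_at, assumption) (simp add: algebra_simps)
  have "evolute K \<phi> $ 1 * velocity (evolute K) \<phi> $ 2 - evolute K \<phi> $ 2 * velocity (evolute K) \<phi> $ 1
      = (p1 \<phi>)\<^sup>2 + p1 \<phi> * p3 \<phi>" for \<phi>
  proof -
    have "(sin \<phi>)\<^sup>2 + (cos \<phi>)\<^sup>2 = 1" by simp
    then show ?thesis unfolding vel unfolding ev
      by (simp only: vector_minus_component vector_scaleR_component unit_vec_nth normal_vec_nth real_scaleR_def) algebra
  qed
  then show ?thesis
    unfolding evolute_area_def oriented_area_def
    using integral_unique[OF has_integral_add[OF J_has_integral(2) integrals_by_parts(2)]] by simp
qed

lemma support_bound: "w \<in> K \<Longrightarrow> w \<bullet> unit_vec \<phi> \<le> p \<phi>"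
  using curve_supports[of w "time \<phi>"] by (simp add: support_fun_time)

lemma support_interior: 
  assumes "z \<in> interior K"
  shows "z \<bullet> unit_vec \<phi> < p \<phi>"
proof -
  obtain e where e: "e > 0" "cball z e \<subseteq> K" using assms mem_interior_cball by blast
  then have "z + e *\<^sub>R unit_vec \<phi> \<in> K" by (auto simp: dist_norm)
  from support_bound[OF this, of \<phi>] have "z \<bullet> unit_vec \<phi> + e * (unit_vec \<phi> \<bullet> unit_vec \<phi>) \<le> p \<phi>"
    by (simp add: inner_add_left)
  moreover have "unit_vec \<phi> \<bullet> unit_vec \<phi> = 1" by (simp flip: power2_norm_eq_inner)
  ultimately show ?thesis using e by simp
qed

text \<open>The first Fourier coefficients of \<open>p + p''\<close> vanish. Geometrically: the curve closes up.\<close>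

lemma rho_first_harmonic:
  "((\<lambda>x. rho x * cos x) has_integral 0) {0..2*pi}" "((\<lambda>x. rho x * sin x) has_integral 0) {0..2*pi}"
proof -
  have "energy rho 1 = 0" by (simp add: energy_rho)
  then have "cos_coeff rho 1 = 0" "sin_coeff rho 1 = 0" by (simp_all add: energy_def sum_power2_eq_zero_iff)
  moreover have "(\<lambda>x. rho x * cos x) integrable_on {0..2*pi}" "(\<lambda>x. rho x * sin x) integrable_on {0..2*pi}"
    by (intro integrable_continuous_real continuous_intros cont_rho)+
  ultimately show "((\<lambda>x. rho x * cos x) has_integral 0) {0..2*pi}" "((\<lambda>x. rho x * sin x) has_integral 0) {0..2*pi}"
    by (simp_all add: has_integral_iff cos_coeff_def sin_coeff_def)
qed

text \<open>Half-open, so that it is mapped injectively onto \<open>K\<close> without the centre.\<close>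

definition polar_box :: "(real^2) set" where
  "polar_box = {v. 0 < v$1 \<and> v$1 \<le> 1 \<and> 0 \<le> v$2 \<and> v$2 < 2*pi}"

lemma polar_box_measurable: "polar_box \<in> sets lebesgue"
proof -
  have "polar_box \<in> sets borel"
    unfolding polar_box_def by measurable
  then show ?thesis by simp
qed

text \<open>Polar coordinates adapted to \<open>K\<close>: the second coordinate selects the boundary point by its normal
  angle, the first one the position on the segment from \<open>z\<close> to it.\<close>

definition sweep :: "real^2 \<Rightarrow> real^2 \<Rightarrow> real^2" where
  "sweep z v = z + v$1 *\<^sub>R (support_point (v$2) - z)"

lemma in_segment_interior:
  assumes z: "z \<in> interior K" and w: "w \<in> K" and s: "0 < s" "s < 1"
  shows "z + s *\<^sub>R (w - z) \<in> interior K"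
proof (cases "w = z")
  case False
  have "z + s *\<^sub>R (w - z) = (1 - s) *\<^sub>R z + s *\<^sub>R w" by (simp add: algebra_simps)
  then have "z + s *\<^sub>R (w - z) \<in> open_segment z w" using False s by (auto simp: in_segment)
  moreover have "open_segment z w \<subseteq> interior K"
    using in_interior_closure_convex_segment[OF convex z] w closure_subset by blast
  ultimately show ?thesis by blast
qed (use z in simp)

lemma frontier_in_K: "w \<in> frontier K \<Longrightarrow> w \<in> K"
  using compact compact_imp_closed frontier_subset_closed by blast

text \<open>Each ray from the interior point \<open>z\<close> meets the frontier exactly once, and the segment from \<open>z\<close> to the
  frontier point is interior up to its endpoint.\<close>

lemma sweep_image:
  assumes z: "z \<in> interior K"
  shows "sweep z ` polar_box = K - {z}" "inj_on (sweep z) polar_box"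
proof -
  have sp: "support_point \<phi> \<in> frontier K" for \<phi> using curve_in_frontier by (simp add: support_point_time)
  have spz: "support_point \<phi> \<noteq> z" for \<phi> using sp[of \<phi>] z by (auto simp: frontier_def)
  have not_int: "support_point \<phi> \<notin> interior K" for \<phi> using sp[of \<phi>] by (auto simp: frontier_def)
  show "sweep z ` polar_box = K - {z}"
  proof
    show "sweep z ` polar_box \<subseteq> K - {z}"
    proof
      fix w assume "w \<in> sweep z ` polar_box"
      then obtain v where v: "v \<in> polar_box" "w = sweep z v" by blast
      then have "w \<noteq> z" using spz by (simp add: sweep_def polar_box_def)
      moreover have "w \<in> K"
      proof (cases "v$1 = 1")
        case True
        then show ?thesis using v sp frontier_in_K by (simp add: sweep_def)
      next
        case False
        then show ?thesis using v in_segment_interior[OF z frontier_in_K[OF sp], of "v$1" "v$2"] interior_subset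
          by (auto simp: sweep_def polar_box_def)
      qed
      ultimately show "w \<in> K - {z}" by simp
    qed
    show "K - {z} \<subseteq> sweep z ` polar_box"
    proof
      fix w assume w: "w \<in> K - {z}"
      then have "w - z \<noteq> 0" by simp
      from ray_to_frontier[OF compact_imp_bounded[OF compact] z this]
      obtain d where d: "0 < d" "z + d *\<^sub>R (w - z) \<in> frontier K" by blast
      have "\<not> d < 1"
        using in_segment_interior[OF z, of w d] d w by (auto simp: frontier_def)
      obtain \<phi> where \<phi>: "\<phi> \<in> {0..<2*pi}" "z + d *\<^sub>R (w - z) = support_point \<phi>"
        using d(2) unfolding frontier_eq[symmetric] by blast
      let ?v = "vector [1/d, \<phi>] :: real^2"
      have "?v \<in> polar_box" using \<open>\<not> d < 1\<close> d \<phi> by (simp add: polar_box_def)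
      moreover have "sweep z ?v = w" using d by (simp add: sweep_def \<phi>(2)[symmetric])
      ultimately show "w \<in> sweep z ` polar_box" by blast
    qed
  qed
  have no_less: False
    if "0 < s" "s < r" and eq: "s *\<^sub>R (support_point \<phi> - z) = r *\<^sub>R (support_point \<psi> - z)" for s r \<phi> \<psi>
  proof -
    have "support_point \<psi> - z = (s / r) *\<^sub>R (support_point \<phi> - z)"
      using arg_cong[OF eq, of "\<lambda>u. (1 / r) *\<^sub>R u"] that(1,2) by simp
    then have "support_point \<psi> = z + (s / r) *\<^sub>R (support_point \<phi> - z)" by (simp add: algebra_simps)
    also have "\<dots> \<in> interior K"
      using that by (intro in_segment_interior z frontier_in_K[OF sp]) auto
    finally show False using not_int by blast
  qed
  show "inj_on (sweep z) polar_box"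
  proof (rule inj_onI)
    fix v w assume v: "v \<in> polar_box" and w: "w \<in> polar_box" and "sweep z v = sweep z w"
    then have eq: "v$1 *\<^sub>R (support_point (v$2) - z) = w$1 *\<^sub>R (support_point (w$2) - z)"
      by (simp add: sweep_def)
    have "v$1 = w$1"
      using no_less[OF _ _ eq] no_less[OF _ _ eq[symmetric]] v w
      by (cases "v$1" "w$1" rule: linorder_cases) (auto simp: polar_box_def)
    moreover from this eq have "support_point (v$2) = support_point (w$2)" using v by (simp add: polar_box_def)
    then have "v$2 = w$2" using inj_onD[OF inj_support_point] v w by (auto simp: polar_box_def)
    ultimately show "v = w" by (simp add: vec_eq_iff forall_2)
  qed
qed

lemma sweep_deriv:
  "(sweep z has_derivative
     (\<lambda>h. h$1 *\<^sub>R (support_point (v$2) - z) + v$1 *\<^sub>R (h$2 *\<^sub>R (rho (v$2) *\<^sub>R normal_vec (v$2))))) (at v within S)"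
proof -
  have "((\<lambda>v. support_point (v$2)) has_derivative (\<lambda>h. h$2 *\<^sub>R (rho (v$2) *\<^sub>R normal_vec (v$2)))) (at v within S)"
    using has_derivative_compose[OF bounded_linear_imp_has_derivative[OF bounded_linear_vec_nth, of 2]
      support_point_deriv[unfolded has_vector_derivative_def]] .
  note d = has_derivative_add[OF has_derivative_const[of z]
    has_derivative_scaleR[OF bounded_linear_imp_has_derivative[OF bounded_linear_vec_nth, of 1]
      has_derivative_diff[OF this has_derivative_const[of z]]]]
  show ?thesis unfolding sweep_def[abs_def] by (rule has_derivative_eq_rhs[OF d]) (auto simp: algebra_simps)
qed

lemma det_columns:
  fixes f :: "real^2 \<Rightarrow> real^2"
  shows "det (matrix f) = f (axis 1 1) $ 1 * f (axis 2 1) $ 2 - f (axis 2 1) $ 1 * f (axis 1 1) $ 2"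
  by (simp add: det_2 matrix_def)

lemma sweep_det:
  fixes v :: "real^2"
  shows "det (matrix (\<lambda>h. h$1 *\<^sub>R (support_point (v$2) - z) + v$1 *\<^sub>R (h$2 *\<^sub>R (rho (v$2) *\<^sub>R normal_vec (v$2)))))
   = v$1 * ((p (v$2) - z \<bullet> unit_vec (v$2)) * rho (v$2))"
proof -
  have sc: "(sin (v$2))\<^sup>2 + (cos (v$2))\<^sup>2 = 1" by simp
  show ?thesis unfolding det_columns
    by (simp add: support_point_def inner_unit_vec axis_def, use sc in algebra)
qed

text \<open>The Jacobian of \<open>sweep\<close> at \<open>v\<close> is \<open>v$1 * h (v$2)\<close> with \<open>h = (p - z \<bullet> u) rho\<close>, twice the area swept per
  angle. If \<open>F' = h\<close>, then the map \<open>G v = ((v$1)\<^sup>2 / 2, F (v$2) - F 0)\<close> has the same Jacobian and maps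
  \<open>polar_box\<close> onto a rectangle. Thus \<open>K\<close> has the area of this rectangle. The
  contribution of \<open>z\<close> vanishes because \<open>rho\<close> is orthogonal to the first harmonics.\<close>

lemma area_eq: "area K = (J0 - J1) / 2"
proof -
  obtain z where z: "z \<in> interior K" using interior by blast
  define h where "h \<phi> = (p \<phi> - z \<bullet> unit_vec \<phi>) * rho \<phi>" for \<phi>
  have h_pos: "h \<phi> > 0" for \<phi> using support_interior[OF z] rho_pos by (simp add: h_def)
  have "continuous_on UNIV h"
    unfolding h_def inner_unit_vec by (intro continuous_intros cont_on cont_rho)
  then obtain F where F: "\<And>\<phi>. (F has_real_derivative h \<phi>) (at \<phi>)" using antiderivative_real by blast
  define V where "V = F (2*pi) - F 0"
  have V: "V = J0 - J1"
  proof -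
    have "(h has_integral V) {0..2*pi}"
      unfolding V_def by (rule has_integral_derivative[OF F]) simp
    moreover have "(h has_integral (J0 - J1) - (z$1 * 0 + z$2 * 0)) {0..2*pi}"
    proof -
      have "h = (\<lambda>\<phi>. p \<phi> * rho \<phi> - (z$1 * (rho \<phi> * cos \<phi>) + z$2 * (rho \<phi> * sin \<phi>)))"
        by (simp add: fun_eq_iff h_def inner_unit_vec algebra_simps)
      then show ?thesis
        by (simp only:) (intro has_integral_diff has_integral_add has_integral_mult_right rho_integrals rho_first_harmonic)
    qed
    ultimately have "V = (J0 - J1) - (z$1 * 0 + z$2 * 0)" by (rule has_integral_unique)
    then show ?thesis by simp
  qed
  have F_cont: "continuous_on S F" for S
    by (rule DERIV_continuous_on) (rule has_field_derivative_at_within[OF F])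
  have F_mono: "F a < F b" if "a < b" for a b
    using that by (rule DERIV_pos_imp_increasing) (use F h_pos in blast)
  define G where "G v = (((v$1)\<^sup>2 / 2) *\<^sub>R axis 1 1 + (F (v$2) - F 0) *\<^sub>R axis 2 1 :: real^2)" for v :: "real^2"
  define G' where "G' v k = ((v$1 * k$1) *\<^sub>R axis 1 1 + (h (v$2) * k$2) *\<^sub>R axis 2 1 :: real^2)" for v k :: "real^2"
  have G_nth [simp]: "G v $ 1 = (v$1)\<^sup>2 / 2" "G v $ 2 = F (v$2) - F 0" for v by (simp_all add: G_def axis_def)
  have G_deriv: "(G has_derivative G' v) (at v within polar_box)" for v
  proof -
    have 1: "((\<lambda>v::real^2. v$i) has_derivative (\<lambda>k. k$i)) (at v within polar_box)" for i
      by (rule bounded_linear_imp_has_derivative[OF bounded_linear_vec_nth])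
    have 2: "((\<lambda>v::real^2. F (v$2)) has_derivative (\<lambda>k. h (v$2) * k$2)) (at v within polar_box)"
      using has_derivative_compose[OF 1[of 2] F[unfolded has_field_derivative_def]] .
    show ?thesis unfolding G_def[abs_def] G'_def[abs_def]
      by (auto intro!: derivative_eq_intros 1 2 simp: fun_eq_iff algebra_simps)
  qed
  have G_inj: "inj_on G polar_box"
  proof (rule inj_onI)
    fix v w assume v: "v \<in> polar_box" and w: "w \<in> polar_box" and eq: "G v = G w"
    have "(v$1)\<^sup>2 = (w$1)\<^sup>2" "F (v$2) = F (w$2)"
      using arg_cong[OF eq, of "\<lambda>u. u$1"] arg_cong[OF eq, of "\<lambda>u. u$2"] by simp_all
    then have "v$1 = w$1" "v$2 = w$2"
      using v w F_mono by (auto simp: polar_box_def power2_eq_iff) (metis linorder_neq_iff)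
    then show "v = w" by (simp add: vec_eq_iff forall_2)
  qed
  have G_image: "G ` polar_box = {u. 0 < u$1 \<and> u$1 \<le> 1/2 \<and> 0 \<le> u$2 \<and> u$2 < V}" (is "_ = ?B")
  proof
    show "G ` polar_box \<subseteq> ?B"
    proof
      fix u assume "u \<in> G ` polar_box"
      then obtain v where v: "v \<in> polar_box" "u = G v" by blast
      then have "(v$1)\<^sup>2 \<le> 1" "F 0 \<le> F (v$2)" "F (v$2) < F (2*pi)"
        using F_mono[of 0 "v$2"] F_mono[of "v$2" "2*pi"]
        by (cases "v$2 = 0"; force simp: polar_box_def power_le_one)+
      then show "u \<in> ?B" using v by (simp add: V_def polar_box_def)
    qed
    show "?B \<subseteq> G ` polar_box"
    proof
      fix u assume u: "u \<in> ?B"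
      have "\<exists>\<phi>\<ge>0. \<phi> \<le> 2*pi \<and> F \<phi> = F 0 + u$2"
        using u by (intro IVT' F_cont) (auto simp: V_def)
      then obtain \<phi> where \<phi>: "0 \<le> \<phi>" "\<phi> \<le> 2*pi" "F \<phi> = F 0 + u$2" by blast
      moreover have "\<phi> \<noteq> 2*pi" using \<phi>(3) u by (auto simp: V_def)
      ultimately have "vector [sqrt (2 * u$1), \<phi>] \<in> polar_box" "G (vector [sqrt (2 * u$1), \<phi>]) = u"
        using u by (auto simp: polar_box_def vec_eq_iff forall_2)
      then show "u \<in> G ` polar_box" by (metis imageI)
    qed
  qed
  have V_pos: "V > 0" using F_mono[of 0 "2*pi"] by (simp add: V_def)
  have B: "?B \<in> lmeasurable \<and> measure lebesgue ?B = V / 2"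
  proof -
    let ?a = "vector [0, 0] :: real^2" and ?b = "vector [1/2, V] :: real^2"
    have sub: "box ?a ?b \<subseteq> ?B" "?B \<subseteq> cbox ?a ?b" by (auto simp: mem_box_cart forall_2)
    have c: "measure lebesgue (cbox ?a ?b) = V / 2"
      using V_pos by (simp add: content_cbox_cart interval_ne_empty_cart forall_2 UNIV_2 less_imp_le)
    have "?B \<in> sets borel" by measurable
    then have lm: "?B \<in> lmeasurable" using sub(2) by (intro bounded_set_imp_lmeasurable bounded_subset[OF bounded_cbox sub(2)]) simp
    moreover have "measure lebesgue ?B \<le> measure lebesgue (cbox ?a ?b)"
      by (rule measure_mono_fmeasurable[OF sub(2)]) (use lm in auto)
    moreover have "measure lebesgue (box ?a ?b) \<le> measure lebesgue ?B"
      by (rule measure_mono_fmeasurable[OF sub(1)]) (use lm in auto)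
    moreover have "measure lebesgue (box ?a ?b) = measure lebesgue (cbox ?a ?b)"
      by (simp add: measure_lborel_box_eq measure_lborel_cbox_eq)
    ultimately show ?thesis using c by simp
  qed
  have "((\<lambda>v. \<bar>det (matrix (G' v))\<bar>) has_integral V / 2) polar_box"
    using has_measure_differentiable_image[OF polar_box_measurable G_deriv G_inj] B unfolding G_image by blast
  moreover have "det (matrix (G' v)) = v$1 * h (v$2)" for v
    unfolding det_columns by (simp add: G'_def axis_def)
  ultimately have "((\<lambda>v. \<bar>v$1 * h (v$2)\<bar>) has_integral V / 2) polar_box" by simp
  then have "sweep z ` polar_box \<in> lmeasurable \<and> measure lebesgue (sweep z ` polar_box) = V / 2"
    unfolding has_measure_differentiable_image[OF polar_box_measurable sweep_deriv sweep_image(2)[OF z]]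
      sweep_det h_def .
  then have "measure lebesgue (K - {z}) = V / 2" unfolding sweep_image(1)[OF z] by simp
  moreover have "measure lebesgue (K - {z}) = measure lebesgue K"
    using compact by (intro measure_Diff_null_set) (auto simp: lmeasurable_compact fmeasurableD negligible_iff_null_sets[symmetric])
  ultimately show ?thesis by (simp add: area_def V)
qed

end

section \<open>Circumradius, inradius and disks\<close>

context convex_oval
begin

text \<open>A point outside \<open>K\<close> is separated from \<open>K\<close> by a line, and it then violates the support condition for
  the normal of that line.\<close>

lemma in_K_iff_support: "w \<in> K \<longleftrightarrow> (\<forall>\<phi>\<in>{0..2*pi}. w \<bullet> unit_vec \<phi> \<le> p \<phi>)"
proof
  assume *: "\<forall>\<phi>\<in>{0..2*pi}. w \<bullet> unit_vec \<phi> \<le> p \<phi>"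
  show "w \<in> K"
  proof (rule ccontr)
    assume "w \<notin> K"
    from separating_hyperplane_closed_point[OF convex compact_imp_closed[OF compact] this]
    obtain a b where ab: "a \<bullet> w < b" "\<And>x. x \<in> K \<Longrightarrow> b < a \<bullet> x" by blast
    obtain \<phi> where \<phi>: "0 \<le> \<phi>" "\<phi> < 2*pi" "- a = norm (- a) *\<^sub>R unit_vec \<phi>"
      using polar_decomposition by blast
    have sp: "support_point \<phi> \<in> K"
      using curve_in_frontier frontier_in_K by (simp add: support_point_time)
    have "(- a) \<bullet> support_point \<phi> < (- a) \<bullet> w" using ab(1) ab(2)[OF sp] by simp
    then have "norm (- a) * (unit_vec \<phi> \<bullet> support_point \<phi>) < norm (- a) * (unit_vec \<phi> \<bullet> w)"
      by (subst (asm) (1 2) \<phi>(3)) simp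
    then have "support_point \<phi> \<bullet> unit_vec \<phi> < w \<bullet> unit_vec \<phi>"
      using mult_less_cancel_left_pos[of "norm (- a)"] by (cases "a = 0") (simp_all add: inner_commute)
    moreover have "support_point \<phi> \<bullet> unit_vec \<phi> = p \<phi>"
      by (simp add: support_point_time support_fun_time)
    ultimately show False using * \<phi> by force
  qed
qed (simp add: support_bound)

text \<open>The support function of the disk with centre \<open>c\<close> and radius \<open>q\<close> is \<open>c \<bullet> u + q\<close>, and inclusion of convex
  sets is comparison of support functions. The radius \<open>q - d\<close> may be negative.\<close>

lemma near_disk:
  assumes "\<And>\<phi>. \<phi> \<in> {0..2*pi} \<Longrightarrow> \<bar>p \<phi> - c \<bullet> unit_vec \<phi> - q\<bar> \<le> d"
  shows "K \<subseteq> cball c (q + d)" "cball c (q - d) \<subseteq> K"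
proof -
  show "K \<subseteq> cball c (q + d)"
  proof
    fix w assume w: "w \<in> K"
    obtain \<phi> where \<phi>: "0 \<le> \<phi>" "\<phi> < 2*pi" "w - c = norm (w - c) *\<^sub>R unit_vec \<phi>"
      using polar_decomposition by blast
    have "(w - c) \<bullet> unit_vec \<phi> = norm (w - c) * (unit_vec \<phi> \<bullet> unit_vec \<phi>)"
      by (subst \<phi>(3)) simp
    then have "norm (w - c) = w \<bullet> unit_vec \<phi> - c \<bullet> unit_vec \<phi>"
      by (simp add: inner_diff_left flip: power2_norm_eq_inner)
    then show "w \<in> cball c (q + d)"
      using assms[of \<phi>] support_bound[OF w, of \<phi>] \<phi>(1,2) by (simp add: dist_norm norm_minus_commute)
  qed
  show "cball c (q - d) \<subseteq> K"
  proof
    fix w assume "w \<in> cball c (q - d)"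
    then have w: "norm (w - c) \<le> q - d" by (simp add: dist_norm norm_minus_commute)
    have "w \<bullet> unit_vec \<phi> \<le> p \<phi>" if "\<phi> \<in> {0..2*pi}" for \<phi>
    proof -
      have "(w - c) \<bullet> unit_vec \<phi> \<le> norm (w - c)"
        using norm_cauchy_schwarz[of "w - c" "unit_vec \<phi>"] by simp
      then show ?thesis using assms[OF that] w by (simp add: inner_diff_left)
    qed
    then show "w \<in> K" by (simp add: in_K_iff_support)
  qed
qed

lemma inradius_le_circumradius: "inradius K \<le> circumradius K"
  and circumradius_le: "K \<subseteq> cball c R \<Longrightarrow> circumradius K \<le> R"
  and inradius_ge: "cball c r \<subseteq> K \<Longrightarrow> r \<le> inradius K"
proof -
  let ?O = "{r. 0 \<le> r \<and> (\<exists>x. K \<subseteq> cball x r)}" and ?I = "{r. 0 \<le> r \<and> (\<exists>x. cball x r \<subseteq> K)}"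
  obtain z where "z \<in> K" using interior interior_subset by blast
  have le: "r \<le> s" if "r \<in> ?I" "s \<in> ?O" for r s
  proof -
    from that obtain x y where "0 \<le> r" and sub: "cball x r \<subseteq> K" "K \<subseteq> cball y s" by blast
    moreover have "cball x r \<subseteq> cball y s" using sub by (rule order_trans)
    ultimately show ?thesis using zero_le_dist[of x y] unfolding cball_subset_cball_iff by linarith
  qed
  obtain b c where "K \<subseteq> cball c b" using compact_imp_bounded[OF compact] bounded_subset_cball by blast
  moreover from subsetD[OF this \<open>z \<in> K\<close>] have "0 \<le> b"
    using zero_le_dist[of c z] unfolding mem_cball by linarith
  ultimately have "b \<in> ?O" by blast
  have "0 \<in> ?I" using \<open>z \<in> K\<close> by auto
  show "inradius K \<le> circumradius K"
    unfolding inradius_def circumradius_def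
    using \<open>b \<in> ?O\<close> \<open>0 \<in> ?I\<close> le by (intro cSup_least cInf_greatest) blast+
  show "circumradius K \<le> R" if "K \<subseteq> cball c R" for c R
  proof -
    have "0 \<le> dist c z" "dist c z \<le> R" using that \<open>z \<in> K\<close> by auto
    then have "0 \<le> R" by linarith
    then show ?thesis unfolding circumradius_def
      using that by (intro cInf_lower bdd_belowI[of _ 0]) auto
  qed
  show "r \<le> inradius K" if "cball c r \<subseteq> K" for c r
  proof -
    have bdd: "bdd_above ?I" using le[OF _ \<open>b \<in> ?O\<close>] by (rule bdd_aboveI)
    show ?thesis
    proof (cases "r \<ge> 0")
      case True
      then show ?thesis unfolding inradius_def using that bdd by (intro cSup_upper) auto
    next
      case False
      moreover have "0 \<le> inradius K" unfolding inradius_def by (rule cSup_upper[OF \<open>0 \<in> ?I\<close> bdd])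
      ultimately show ?thesis by simp
    qed
  qed
qed

lemma rho_bounds:
  assumes "\<phi> \<in> {0..2*pi}"
  shows "min_curv_radius K \<le> rho \<phi>" "rho \<phi> \<le> max_curv_radius K"
proof -
  have "compact (rho ` {0..2*pi})" by (intro compact_continuous_image cont_rho) simp
  then have "bdd_above (rho ` {0..2*pi})" "bdd_below (rho ` {0..2*pi})"
    by (auto dest: compact_imp_bounded bounded_imp_bdd_above bounded_imp_bdd_below)
  then show "min_curv_radius K \<le> rho \<phi>" "rho \<phi> \<le> max_curv_radius K"
    unfolding min_curv_radius_def max_curv_radius_def curv_radius_eq
    using assms by (auto intro: cINF_lower cSUP_upper)
qed

lemma nearly_round:
  obtains c where "K \<subseteq> cball c (L / (2*pi) + (max_curv_radius K - min_curv_radius K) / 3)"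
    "cball c (L / (2*pi) - (max_curv_radius K - min_curv_radius K) / 3) \<subseteq> K"
proof -
  obtain a b where "\<And>\<phi>. \<phi> \<in> {0..2*pi} \<Longrightarrow>
      \<bar>p \<phi> - (a * cos \<phi> + b * sin \<phi>) - L / (2*pi)\<bar> \<le> (max_curv_radius K - min_curv_radius K) / 3"
    using support_near_constant rho_bounds by blast
  then have "\<And>\<phi>. \<phi> \<in> {0..2*pi} \<Longrightarrow>
      \<bar>p \<phi> - vector [a, b] \<bullet> unit_vec \<phi> - L / (2*pi)\<bar> \<le> (max_curv_radius K - min_curv_radius K) / 3"
    by (simp add: inner_unit_vec)
  from near_disk[OF this] show thesis by (rule that)
qed

lemma radii_oscillation:
  "0 \<le> circumradius K - inradius K"
  "circumradius K - inradius K \<le> 2/3 * (max_curv_radius K - min_curv_radius K)"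
proof -
  show "0 \<le> circumradius K - inradius K" using inradius_le_circumradius by simp
  obtain c where "K \<subseteq> cball c (L / (2*pi) + (max_curv_radius K - min_curv_radius K) / 3)"
    "cball c (L / (2*pi) - (max_curv_radius K - min_curv_radius K) / 3) \<subseteq> K"
    by (rule nearly_round)
  from circumradius_le[OF this(1)] inradius_ge[OF this(2)]
  show "circumradius K - inradius K \<le> 2/3 * (max_curv_radius K - min_curv_radius K)" by argo
qed

lemma disk_if_equal_radii:
  assumes "max_curv_radius K = min_curv_radius K"
  shows "is_disk K"
proof -
  obtain c where "K \<subseteq> cball c (L / (2*pi) + (max_curv_radius K - min_curv_radius K) / 3)"
    "cball c (L / (2*pi) - (max_curv_radius K - min_curv_radius K) / 3) \<subseteq> K"
    by (rule nearly_round)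
  then have K: "K = cball c (L / (2*pi))" by (simp add: assms)
  then have "interior K = ball c (L / (2*pi))" using interior_cball by metis
  then have "L / (2*pi) > 0" using interior by (metis ball_eq_empty not_le)
  with K show ?thesis unfolding is_disk_def by blast
qed

text \<open>The support function of a disk is \<open>r\<close> plus a first harmonic, which \<open>rho\<close> annihilates.\<close>

lemma disk_constant_radius:
  assumes "is_disk K"
  obtains r where "r > 0" "\<And>\<phi>. rho \<phi> = r" "circumradius K = inradius K"
proof -
  from assms obtain c r where r: "r > 0" and K: "K = cball c r" by (auto simp: is_disk_def)
  have "support_fun K \<phi> = c \<bullet> unit_vec \<phi> + r" for \<phi>
    unfolding support_fun_def
  proof (rule cSup_eq_maximum)
    have "(c + r *\<^sub>R unit_vec \<phi>) \<bullet> unit_vec \<phi> = c \<bullet> unit_vec \<phi> + r"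
      by (simp add: inner_add_left flip: power2_norm_eq_inner)
    moreover have "c + r *\<^sub>R unit_vec \<phi> \<in> K" using r by (simp add: K dist_norm)
    ultimately show "c \<bullet> unit_vec \<phi> + r \<in> (\<lambda>x. x \<bullet> unit_vec \<phi>) ` K" by (metis imageI)
    fix y assume "y \<in> (\<lambda>x. x \<bullet> unit_vec \<phi>) ` K"
    then obtain w where w: "w \<in> K" "y = w \<bullet> unit_vec \<phi>" by blast
    have "(w - c) \<bullet> unit_vec \<phi> \<le> norm (w - c)"
      using norm_cauchy_schwarz[of "w - c" "unit_vec \<phi>"] by simp
    then show "y \<le> c \<bullet> unit_vec \<phi> + r"
      using w by (simp add: K dist_norm norm_minus_commute inner_diff_left)
  qed
  then have p: "p = (\<lambda>\<phi>. c$1 * cos \<phi> + c$2 * sin \<phi> + r)" by (simp add: fun_eq_iff inner_unit_vec)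
  have p1: "p1 = (\<lambda>\<phi>. c$2 * cos \<phi> - c$1 * sin \<phi>)"
  proof
    fix \<phi>
    have "(p has_real_derivative c$2 * cos \<phi> - c$1 * sin \<phi>) (at \<phi>)"
      unfolding p by (auto intro!: derivative_eq_intros)
    then show "p1 \<phi> = c$2 * cos \<phi> - c$1 * sin \<phi>" using d0 DERIV_unique by blast
  qed
  have p2: "p2 \<phi> = - c$2 * sin \<phi> - c$1 * cos \<phi>" for \<phi>
  proof -
    have "(p1 has_real_derivative - c$2 * sin \<phi> - c$1 * cos \<phi>) (at \<phi>)"
      unfolding p1 by (auto intro!: derivative_eq_intros)
    then show ?thesis using d1 DERIV_unique by blast
  qed
  have "circumradius K \<le> r" "r \<le> inradius K"
    using circumradius_le[of c r] inradius_ge[of c r] by (simp_all add: K)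
  then have "circumradius K = inradius K" using inradius_le_circumradius by linarith
  moreover have "rho \<phi> = r" for \<phi> unfolding rho_def p2 by (simp add: p)
  ultimately show thesis using that r by blast
qed

end

section \<open>The inequalities\<close>

context convex_oval
begin

lemma R_eq: "integral {0..2*pi} (\<lambda>\<theta>. (curv_radius K \<theta>)\<^sup>2) = J0 - 2*J1 + J2"
  unfolding curv_radius_eq by (rule integral_unique[OF rho_integrals(2)])

lemma B_eq: "integral {0..2*pi} (\<lambda>\<theta>. (evolute_curv_radius K \<theta>)\<^sup>2) = J1 - 2*J2 + J3"
  unfolding evolute_curv_radius_eq power2_abs by (rule integral_unique[OF rho_integrals(3)])

lemma abs_evolute_area_eq: "\<bar>evolute_area K\<bar> = (J2 - J1) / 2"
  using wirtinger(2) by (simp add: evolute_area_eq)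

lemma B_nonneg: "0 \<le> J1 - 2*J2 + J3"
  by (rule has_integral_nonneg[OF rho_integrals(3)]) simp

lemma area_pos: "area K > 0"
proof -
  have "measure lebesgue K \<noteq> 0"
    using interior compact negligible_iff_measure0[of K] lmeasurable_compact[OF compact]
      negligible_subset[OF _ interior_subset[of K]] open_not_negligible[OF open_interior, of K]
    by blast
  then show ?thesis unfolding area_def using measure_nonneg[of lebesgue K] by linarith
qed

text \<open>Nothing but Wirtinger's inequality for the support function.\<close>

lemma isoperimetric: "4 * pi * area K \<le> (boundary_length K)\<^sup>2"
  using wirtinger(1) by (simp add: area_eq boundary_length_eq J0_centred_def field_simps)

lemma inequality_a:
  "20 * area K < 2 * (boundary_length K)\<^sup>2 + 8 * \<bar>evolute_area K\<bar>
     + 2 * integral {0..2*pi} (\<lambda>\<theta>. (evolute_curv_radius K \<theta>)\<^sup>2)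
     + arc_integral (boundary_curve K) 0 (2*pi) (\<lambda>\<theta>. (curv K \<theta>)\<^sup>2)"
proof -
  have "0 \<le> integral {0..2*pi} (\<lambda>\<theta>. (evolute_curv_radius K \<theta>)\<^sup>2)"
    unfolding B_eq by (rule B_nonneg)
  moreover have "0 \<le> arc_integral (boundary_curve K) 0 (2*pi) (\<lambda>\<theta>. (curv K \<theta>)\<^sup>2)"
    unfolding arc_integral_def
    by (cases "(\<lambda>\<theta>. (curv K \<theta>)\<^sup>2 * norm (velocity (boundary_curve K) \<theta>)) integrable_on {0..2*pi}")
      (simp_all add: integral_nonneg not_integrable_integral)
  moreover have "20 * area K < 2 * (boundary_length K)\<^sup>2"
  proof -
    have "20 * area K < 8 * pi * area K" using area_pos pi_gt3 by simp
    then show ?thesis using isoperimetric by simp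
  qed
  ultimately show ?thesis by linarith
qed

text \<open>The difference of the two sides has the frequency polynomial
  \<open>(\<pi> - 1) (m - 1) (m - 4) (m + 4) = (\<pi> - 1) (m (m - 1) (m - 4) + 4 (m - 1) (m - 4))\<close> with \<open>m = n\<^sup>2\<close>.\<close>

lemma inequality_b:
  "(8*pi - 8) / pi * L\<^sup>2 + (8 - 2*pi) * ((J2 - J1) / 2)
     \<le> 3 * (J0 - 2*J1 + J2) + (32*pi - 38) * ((J0 - J1) / 2) + (pi - 1) * (J1 - 2*J2 + J3)"
proof -
  have "3 * (J0 - 2*J1 + J2) + (32*pi - 38) * ((J0 - J1) / 2) + (pi - 1) * (J1 - 2*J2 + J3)
      - ((8*pi - 8) / pi * L\<^sup>2 + (8 - 2*pi) * ((J2 - J1) / 2))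
    = (pi - 1) * ((J3 - 5*J2 + 4*J1) + 4 * (J2 - 5*J1 + 4*J0_centred))"
    by (simp add: J0_centred_def field_simps)
  also have "\<dots> \<ge> 0"
    using second_order_wirtinger pi_gt3 by (intro mult_nonneg_nonneg) auto
  finally show ?thesis by simp
qed

text \<open>The frequency polynomial of the difference is \<open>m - 1\<close> times a quadratic polynomial with leading
  coefficient \<open>3/4\<close> and value \<open>13 - 4 \<pi> > 0\<close> at \<open>m = 4\<close>. Subtracting \<open>e (m\<^sup>2 - 1)\<close>, with \<open>e\<close> chosen to
  match this value, leaves a multiple of \<open>(m - 1) (m - 4)\<close>.\<close>

lemma inequality_c:
  "13/7 * L\<^sup>2 + pi/7 * ((J2 - J1) / 2)
     \<le> (J0 - 2*J1 + J2) + (52*pi/7 - 2) * ((J0 - J1) / 2) + 3/4 * (J1 - 2*J2 + J3)"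
proof -
  define e where "e = (13 - 4*pi) / 5"
  have e: "e \<ge> 0" using pi_approx by (simp add: e_def)
  have "(J0 - 2*J1 + J2) + (52*pi/7 - 2) * ((J0 - J1) / 2) + 3/4 * (J1 - 2*J2 + J3)
      - (13/7 * L\<^sup>2 + pi/7 * ((J2 - J1) / 2))
    = 3/4 * (J3 - 5*J2 + 4*J1) + (26*pi/7 + e)/4 * (J2 - 5*J1 + 4*J0_centred) + e * (J2 - J0_centred)"
    by (simp add: J0_centred_def e_def field_simps)
  also have "\<dots> \<ge> 0"
  proof (rule add_nonneg_nonneg[OF add_nonneg_nonneg])
    show "0 \<le> 3/4 * (J3 - 5*J2 + 4*J1)" using second_order_wirtinger(2) by simp
    show "0 \<le> (26*pi/7 + e)/4 * (J2 - 5*J1 + 4*J0_centred)"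
      by (rule mult_nonneg_nonneg[OF _ second_order_wirtinger(1)]) (use e in simp)
    show "0 \<le> e * (J2 - J0_centred)"
      by (rule mult_nonneg_nonneg[OF e]) (use wirtinger in linarith)
  qed
  finally show ?thesis by simp
qed

text \<open>The factor \<open>8/9\<close> is less than 1, which settles the case of equality in (d).\<close>

lemma radii_difference_bound:
  "2 * pi * (circumradius K - inradius K)\<^sup>2 \<le> 8/9 * (pi * (max_curv_radius K - min_curv_radius K)\<^sup>2)"
proof -
  let ?o = "max_curv_radius K - min_curv_radius K"
  have "(circumradius K - inradius K)\<^sup>2 \<le> (2/3 * ?o)\<^sup>2"
    by (rule power_mono[OF radii_oscillation(2,1)])
  then have "2 * pi * (circumradius K - inradius K)\<^sup>2 \<le> 2 * pi * (2/3 * ?o)\<^sup>2"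
    by (intro mult_left_mono) auto
  also have "\<dots> = 8/9 * (pi * ?o\<^sup>2)" unfolding power_mult_distrib by (simp add: power_divide)
  finally show ?thesis .
qed

end

theorem corollary3p5:
  fixes K :: "(real^2) set" and \<gamma> :: "real \<Rightarrow> real^2"
  assumes K: "strictly_convex_domain_enclosed_by K \<gamma>"
  defines "L \<equiv> boundary_length K"
    and "A \<equiv> area K"
    and "A' \<equiv> \<bar>evolute_area K\<bar>"
    and "R \<equiv> integral {0..2*pi} (\<lambda>\<theta>. (curv_radius K \<theta>)^2)"
    and "B \<equiv> integral {0..2*pi} (\<lambda>\<theta>. (evolute_curv_radius K \<theta>)^2)"
    and "C \<equiv> arc_integral (boundary_curve K) 0 (2*pi) (\<lambda>\<theta>. (curv K \<theta>)^2)"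
    and "\<rho>M \<equiv> max_curv_radius K" and "\<rho>m \<equiv> min_curv_radius K"
    and "\<rho>e \<equiv> circumradius K" and "\<rho>i \<equiv> inradius K"
  shows
    \<comment> \<open>(i)\<close>
    "(2 * L^2 + 8 * A' + 2 * B + C \<ge> 20 * A \<and>
      3 * R + (32*pi - 38) * A + (pi - 1) * B \<ge> (8*pi - 8) / pi * L^2 + (8 - 2*pi) * A' \<and>
      R + (52*pi/7 - 2) * A + 3/4 * B \<ge> 13/7 * L^2 + pi/7 * A' \<and>
      (\<forall>\<epsilon>\<in>{0..1/2}. A' + \<epsilon> * B + pi * (\<rho>M - \<rho>m)^2 \<ge> 2 * pi * (\<rho>e - \<rho>i)^2)) \<and>
    \<comment> \<open>(ii)\<close>
     2 * L^2 + 8 * A' + 2 * B + C > 20 * A \<and>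
    \<comment> \<open>(iii)\<close>
     (is_disk K \<longrightarrow>
      3 * R + (32*pi - 38) * A + (pi - 1) * B = (8*pi - 8) / pi * L^2 + (8 - 2*pi) * A' \<and>
      R + (52*pi/7 - 2) * A + 3/4 * B = 13/7 * L^2 + pi/7 * A') \<and>
    \<comment> \<open>(iv)\<close>
     (\<forall>\<epsilon>\<in>{0..1/2}.
        A' + \<epsilon> * B + pi * (\<rho>M - \<rho>m)^2 = 2 * pi * (\<rho>e - \<rho>i)^2 \<longleftrightarrow> is_disk K)"
proof -
  interpret oval: convex_oval K \<gamma> using K by unfold_locales
  have eqs: "L = oval.L" "A = (oval.J0 - oval.J1) / 2" "A' = (oval.J2 - oval.J1) / 2"
    "R = oval.J0 - 2 * oval.J1 + oval.J2" "B = oval.J1 - 2 * oval.J2 + oval.J3"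
    unfolding L_def A_def A'_def R_def B_def
    by (rule oval.boundary_length_eq oval.area_eq oval.abs_evolute_area_eq oval.R_eq oval.B_eq)+
  have a: "20 * A < 2 * L^2 + 8 * A' + 2 * B + C"
    unfolding L_def A_def A'_def B_def C_def by (rule oval.inequality_a)
  have A'_nonneg: "A' \<ge> 0" by (simp add: A'_def)
  have B_nonneg: "B \<ge> 0" unfolding eqs by (rule oval.B_nonneg)
  have gap: "2 * pi * (\<rho>e - \<rho>i)^2 \<le> 8/9 * (pi * (\<rho>M - \<rho>m)^2)"
    unfolding \<rho>M_def \<rho>m_def \<rho>e_def \<rho>i_def by (rule oval.radii_difference_bound)
  have osc: "pi * (\<rho>M - \<rho>m)^2 \<ge> 0" by simp
  have d: "2 * pi * (\<rho>e - \<rho>i)^2 \<le> A' + \<epsilon> * B + pi * (\<rho>M - \<rho>m)^2" if "\<epsilon> \<in> {0..1/2}" for \<epsilon>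
  proof -
    have "\<epsilon> * B \<ge> 0" using that B_nonneg by simp
    then show ?thesis using gap osc A'_nonneg by linarith
  qed
  have disk_if: "is_disk K"
    if "\<epsilon> \<in> {0..1/2}" and eq: "A' + \<epsilon> * B + pi * (\<rho>M - \<rho>m)^2 = 2 * pi * (\<rho>e - \<rho>i)^2" for \<epsilon>
  proof -
    have "\<epsilon> * B \<ge> 0" using that B_nonneg by simp
    then have "pi * (\<rho>M - \<rho>m)^2 = 0" using gap osc A'_nonneg eq by linarith
    then have "max_curv_radius K = min_curv_radius K" by (simp add: \<rho>M_def \<rho>m_def)
    then show ?thesis by (rule oval.disk_if_equal_radii)
  qed
  have disk: "3 * R + (32*pi - 38) * A + (pi - 1) * B = (8*pi - 8) / pi * L^2 + (8 - 2*pi) * A'"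
      "R + (52*pi/7 - 2) * A + 3/4 * B = 13/7 * L^2 + pi/7 * A'"
      "A' + \<epsilon> * B + pi * (\<rho>M - \<rho>m)^2 = 2 * pi * (\<rho>e - \<rho>i)^2" if K_disk: "is_disk K" for \<epsilon>
  proof -
    obtain r where "r > 0" and r: "\<And>\<phi>. oval.rho \<phi> = r" and "circumradius K = inradius K"
      using oval.disk_constant_radius[OF K_disk] by blast
    then have "\<rho>e = \<rho>i" by (simp add: \<rho>e_def \<rho>i_def)
    have "\<rho>M = r" "\<rho>m = r"
      unfolding \<rho>M_def \<rho>m_def max_curv_radius_def min_curv_radius_def oval.curv_radius_eq r by simp_all
    moreover note c = oval.integrals_of_constant_rho[OF r]
    have vals: "L = 2*pi*r" "R = 2*pi*r\<^sup>2" "B = 0" "A = pi*r\<^sup>2" "A' = 0"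
      unfolding eqs c by simp_all
    ultimately show "3 * R + (32*pi - 38) * A + (pi - 1) * B = (8*pi - 8) / pi * L^2 + (8 - 2*pi) * A'"
      "R + (52*pi/7 - 2) * A + 3/4 * B = 13/7 * L^2 + pi/7 * A'"
      "A' + \<epsilon> * B + pi * (\<rho>M - \<rho>m)^2 = 2 * pi * (\<rho>e - \<rho>i)^2"
      using \<open>\<rho>e = \<rho>i\<close> by (simp_all add: field_simps power2_eq_square)
  qed
  show ?thesis
    using a d disk_if disk oval.inequality_b oval.inequality_c unfolding eqs[symmetric] by (auto simp: less_imp_le)
qed

end
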